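(* Let $(D_n)_{n\in\mathbb N}$ be a sequence of subsets of $\mathbb Z^d$ satisfying the geometric assumption, with scaling vectors $\mathbf c_n$, and let $(\xi_v)_{v\in\mathbb Z^d}$ be a stationary real-valued random field satisfying condition $\mathcal D(x_n;K_n)$ for some real sequence $(x_n)_{n\in\mathbb N}$, with associated vectors $\boldsymbol\gamma_n$ and constants $\alpha_n$. Let $(k_n)$ be a sequence of integers satisfying $k_n\to\infty$, $k_n\alpha_n\to0$ and $k_n^{1/d}\boldsymbol\gamma_n=o(\mathbf c_n)$ as $n\to\infty$, such that condition $\mathcal D^\ell(x_n;k_n;\theta)$ is satisfied for some $\theta\in(0,1]$. Then, for all $0\le\tau<\infty$, $$|D_n|\,\mathbb P(\xi_0>x_n)\to\tau\quad\text{if and only if}\quad \mathbb P\bigl(\max_{v\in D_n}\xi_v\le x_n\bigr)\to\exp(-\theta\tau)$$ as $n\to\infty$.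
   Context: Notation: $d\in\mathbb N$; $|\cdot|$ denotes the Euclidean norm of a point, Lebesgue measure of a full-dimensional subset of $\mathbb R^d$, and cardinality of a subset of $\mathbb Z^d$. For a vector $\mathbf r=(r_1,\dots,r_d)$ and $A\subseteq\mathbb R^d$, $\mathbf rA=\{(r_1a_1,\dots,r_da_d):a\in A\}$. $A\oplus B$ is the Minkowski sum, $B(1)$ the closed Euclidean unit ball. For vectors, $\mathbf r_n=o(\mathbf c_n)$ means $r_{n,\ell}/c_{n,\ell}\to0$ for each $\ell$. $M_\xi(A)=\max_{v\in A}\xi_v$, with $M_\xi(\emptyset)=-\infty$. Geometric assumption on $(D_n)$: A convex body is a compact convex subset of $\mathbb R^d$ with non-empty interior; a set is $p$-convex if it is a union of $p$ convex bodies. There are $p\in\mathbb N$ and $p$-convex sets $C_n=\bigcup_{i=1}^pC_{n,i}$ with $D_n=C_n\cap\mathbb Z^d$ and $|C_n|\to\infty$, and vectors $\mathbf c_n=(c_{n,1},\dots,c_{n,d})$ (scaling vectors) with $0<c_{n,\ell}<\infty$ such that (i) $c_{n,\ell}\to\infty$ for all $\ell$; (ii) $c_{n,1}\cdots c_{n,d}\sim|C_n|$; (iii) for some $0<c<\infty$, $C_n\subseteq\mathbf c_n[-c,c]^d$ for all $n$. Boxes: every sequence $(k_n)$ considered consists of positive integers with $k_n\to\infty$ and $k_n^{1/d}=o(c_{n,\ell})$ for all $\ell$. Put $t_{n,k_n}^\ell=\lfloor c_{n,\ell}/k_n^{1/d}\rfloor$, $\mathbf t_{n,k_n}=(t_{n,k_n}^1,\dots,t_{n,k_n}^d)$,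 and for $z\in\mathbb Z^d$, $I_z^{n,k_n}=\mathbf t_{n,k_n}(z+[0,1)^d)$, $J_z^{n,k_n}=I_z^{n,k_n}\cap\mathbb Z^d$, and $D_{n,k_n}^+=\bigcup\{J_z^{n,k_n}: I_z^{n,k_n}\cap C_n\ne\emptyset\}$. $K_n=\mathbb Z^d\cap\mathbf c_n[-c,c]^d$, where $0<c<\infty$ is a fixed constant (which can be chosen independently of $(k_n)$) such that $D_{n,k_n}^+\subseteq K_n$ for all $n$. Condition $\mathcal D(x_n;K_n)$: sets $A,B\subseteq\mathbb Z^d$ are $\boldsymbol\gamma$-separated if $B\subseteq(A\oplus\boldsymbol\gamma B(1))^c$. The condition holds for $(\xi_v)$ if there is an increasing sequence of $d$-dimensional vectors $\boldsymbol\gamma_n$ with $\boldsymbol\gamma_n=o(\mathbf c_n)$ and constants $\alpha_n\to0$ such that for all $n$ and all $\boldsymbol\gamma_n$-separated $A,B\subseteq K_n$, at least one of which is a box, $|\mathbb P(M_\xi(A\cup B)\le x_n)-\mathbb P(M_\xi(A)\le x_n)\mathbb P(M_\xi(B)\le x_n)|\le\alpha_n$. Order: $\preceq$ is an arbitrary fixed translation invariant total order on $\mathbb Z^d$, and $A_v^{n,k_n}=\{z\in(v+\mathbf t_{n,k_n}[-1,1]^d)\cap\mathbb Z^d: v\prec z\}$. Condition $\mathcal D^\ell(x_n;k_n;\theta)$ ($\theta\in[0,1]$): $\mathbb P(M_\xi(A_0^{n,k_n})\le x_n\mid\xi_0>x_n)\to\theta$ as $n\to\infty$. *)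

theory Defs
  imports "HOL-Probability.Probability" "HOL-Library.Landau_Symbols"
begin

text \<open>
  The dimension \<open>d\<close> is \<open>CARD('d)\<close>: \<open>\<real>\<^sup>d\<close> is \<^typ>\<open>real ^ 'd\<close> and \<open>\<int>\<^sup>d\<close> is \<^typ>\<open>int ^ 'd\<close>.
  Multiplication of vectors is componentwise, so \<open>(*) r ` A\<close> is the set obtained from \<open>A\<close> by
  scaling the \<open>l\<close>-th coordinate by \<open>r $ l\<close>.  Addition of sets is the Minkowski sum.
\<close>

definition emb :: "int ^ 'd \<Rightarrow> real ^ 'd" where
  "emb v = (\<chi> l. real_of_int (v $ l))"

definition lattice_points :: "(real ^ 'd) set \<Rightarrow> (int ^ 'd) set" where
  "lattice_points S = {v. emb v \<in> S}"

definition cube :: "real \<Rightarrow> (real ^ 'd::finite) set" where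
  "cube b = cbox (- vec b) (vec b)"

definition vec_smallo :: "(nat \<Rightarrow> real ^ 'd) \<Rightarrow> (nat \<Rightarrow> real ^ 'd) \<Rightarrow> bool" where
  "vec_smallo r c \<longleftrightarrow> (\<forall>l. (\<lambda>n. r n $ l / c n $ l) \<longlonglongrightarrow> 0)"

subsection \<open>Index sets\<close>

definition convex_body :: "(real ^ 'd::finite) set \<Rightarrow> bool" where
  "convex_body S \<longleftrightarrow> compact S \<and> convex S \<and> interior S \<noteq> {}"

definition p_convex :: "nat \<Rightarrow> (real ^ 'd::finite) set \<Rightarrow> bool" where
  "p_convex p S \<longleftrightarrow>
     (\<exists>B :: nat \<Rightarrow> (real ^ 'd) set. (\<forall>i\<in>{1..p}. convex_body (B i)) \<and> S = (\<Union>i\<in>{1..p}. B i))"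

definition geometric_assumption ::
  "(nat \<Rightarrow> (int ^ 'd::finite) set) \<Rightarrow> (nat \<Rightarrow> (real ^ 'd) set) \<Rightarrow> (nat \<Rightarrow> real ^ 'd) \<Rightarrow> bool"
where
  "geometric_assumption D C c \<longleftrightarrow>
     (\<exists>p\<ge>1. \<forall>n. p_convex p (C n)) \<and>
     (\<forall>n. D n = lattice_points (C n)) \<and>
     filterlim (\<lambda>n. measure lebesgue (C n)) at_top sequentially \<and>
     (\<forall>n l. 0 < c n $ l) \<and>
     (\<forall>l. filterlim (\<lambda>n. c n $ l) at_top sequentially) \<and>
     (\<lambda>n. \<Prod>l\<in>UNIV. c n $ l) \<sim>[sequentially] (\<lambda>n. measure lebesgue (C n)) \<and>
     (\<exists>b>0. \<forall>n. C n \<subseteq> (*) (c n) ` cube b)"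

subsection \<open>Blocks\<close>

text \<open>
  In the following definitions \<open>c\<close>, \<open>C\<close> and \<open>k\<close> are the scaling vector, the set and the number
  of blocks for one fixed index \<open>n\<close>.
\<close>

definition admissible :: "(nat \<Rightarrow> real ^ 'd::finite) \<Rightarrow> (nat \<Rightarrow> nat) \<Rightarrow> bool" where
  "admissible c k \<longleftrightarrow>
     (\<forall>n. 0 < k n) \<and>
     filterlim k at_top sequentially \<and>
     (\<forall>l. (\<lambda>n. root CARD('d) (real (k n)) / c n $ l) \<longlonglongrightarrow> 0)"

definition block_side :: "real ^ 'd::finite \<Rightarrow> nat \<Rightarrow> real ^ 'd" where
  "block_side c k = (\<chi> l. real_of_int \<lfloor>c $ l / root CARD('d) (real k)\<rfloor>)"

definition block_I :: "real ^ 'd::finite \<Rightarrow> nat \<Rightarrow> int ^ 'd \<Rightarrow> (real ^ 'd) set" where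
  "block_I c k z = (*) (block_side c k) ` ((+) (emb z) ` {a. \<forall>l. 0 \<le> a $ l \<and> a $ l < 1})"

definition block_J :: "real ^ 'd::finite \<Rightarrow> nat \<Rightarrow> int ^ 'd \<Rightarrow> (int ^ 'd) set" where
  "block_J c k z = lattice_points (block_I c k z)"

definition D_plus :: "(real ^ 'd::finite) set \<Rightarrow> real ^ 'd \<Rightarrow> nat \<Rightarrow> (int ^ 'd) set" where
  "D_plus C c k = \<Union> {block_J c k z | z. block_I c k z \<inter> C \<noteq> {}}"

definition K_set :: "real \<Rightarrow> real ^ 'd::finite \<Rightarrow> (int ^ 'd) set" where
  "K_set b c = lattice_points ((*) c ` cube b)"

subsection \<open>The random field\<close>

definition stationary :: "'w measure \<Rightarrow> (int ^ 'd \<Rightarrow> 'w \<Rightarrow> real) \<Rightarrow> bool" where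
  "stationary M \<xi> \<longleftrightarrow>
     (\<forall>h. distr M (\<Pi>\<^sub>M v\<in>UNIV. borel) (\<lambda>\<omega> v. \<xi> (v + h) \<omega>) =
          distr M (\<Pi>\<^sub>M v\<in>UNIV. borel) (\<lambda>\<omega> v. \<xi> v \<omega>))"

text \<open>The supremum is a maximum on finite nonempty sets, and it is \<open>-\<infinity>\<close> on the empty set.\<close>

definition field_max :: "(int ^ 'd \<Rightarrow> 'w \<Rightarrow> real) \<Rightarrow> (int ^ 'd) set \<Rightarrow> 'w \<Rightarrow> ereal" where
  "field_max \<xi> A \<omega> = (SUP v\<in>A. ereal (\<xi> v \<omega>))"

definition separated :: "real ^ 'd::finite \<Rightarrow> (int ^ 'd) set \<Rightarrow> (int ^ 'd) set \<Rightarrow> bool" where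
  "separated g A B \<longleftrightarrow> emb ` B \<subseteq> - (emb ` A + (*) g ` cball 0 1)"

definition lattice_box :: "(int ^ 'd) set \<Rightarrow> bool" where
  "lattice_box A \<longleftrightarrow> (\<exists>a b. A = {v. \<forall>l. a $ l \<le> v $ l \<and> v $ l \<le> b $ l})"

text \<open>The vectors \<open>\<gamma>\<close> and constants \<open>\<alpha>\<close> are exposed as parameters, since later rate conditions refer to them.\<close>

definition cond_D ::
  "'w measure \<Rightarrow> (int ^ 'd::finite \<Rightarrow> 'w \<Rightarrow> real) \<Rightarrow> (nat \<Rightarrow> real) \<Rightarrow> (nat \<Rightarrow> (int ^ 'd) set) \<Rightarrow>
     (nat \<Rightarrow> real ^ 'd) \<Rightarrow> (nat \<Rightarrow> real ^ 'd) \<Rightarrow> (nat \<Rightarrow> real) \<Rightarrow> bool"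
where
  "cond_D M \<xi> x K c \<gamma> \<alpha> \<longleftrightarrow>
     (\<forall>l. incseq (\<lambda>n. \<gamma> n $ l)) \<and>
     vec_smallo \<gamma> c \<and>
     \<alpha> \<longlonglongrightarrow> 0 \<and>
     (\<forall>n A B. A \<subseteq> K n \<and> B \<subseteq> K n \<and> separated (\<gamma> n) A B \<and> (lattice_box A \<or> lattice_box B) \<longrightarrow>
        \<bar>\<P>(\<omega> in M. field_max \<xi> (A \<union> B) \<omega> \<le> ereal (x n)) -
         \<P>(\<omega> in M. field_max \<xi> A \<omega> \<le> ereal (x n)) * \<P>(\<omega> in M. field_max \<xi> B \<omega> \<le> ereal (x n))\<bar> \<le> \<alpha> n)"

text \<open>A total order is given by its reflexive relation; \<open>(u, v) \<in> R\<close> means \<open>u \<preceq> v\<close>.\<close>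

definition transl_inv_order :: "(int ^ 'd) rel \<Rightarrow> bool" where
  "transl_inv_order R \<longleftrightarrow>
     linear_order R \<and> (\<forall>u v w. (u, v) \<in> R \<longrightarrow> (u + w, v + w) \<in> R)"

definition A_set ::
  "(int ^ 'd::finite) rel \<Rightarrow> real ^ 'd \<Rightarrow> nat \<Rightarrow> int ^ 'd \<Rightarrow> (int ^ 'd) set"
where
  "A_set R c k v =
     {z \<in> lattice_points ((+) (emb v) ` (*) (block_side c k) ` cube 1). (v, z) \<in> R \<and> v \<noteq> z}"

text \<open>
  The library's conditional probability is \<open>0\<close> when the conditioning event is a null set.  For
  \<open>\<theta> > 0\<close> the limit below therefore forces the conditioning events to have positive probability
  for all large \<open>n\<close>.
\<close>

definition cond_D_local ::
  "'w measure \<Rightarrow> (int ^ 'd::finite \<Rightarrow> 'w \<Rightarrow> real) \<Rightarrow> (int ^ 'd) rel \<Rightarrow> (nat \<Rightarrow> real ^ 'd) \<Rightarrow>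
     (nat \<Rightarrow> real) \<Rightarrow> (nat \<Rightarrow> nat) \<Rightarrow> real \<Rightarrow> bool"
where
  "cond_D_local M \<xi> R c x k \<theta> \<longleftrightarrow>
     (\<lambda>n. \<P>(\<omega> in M. field_max \<xi> (A_set R (c n) (k n) 0) \<omega> \<le> ereal (x n) \<bar> \<xi> 0 \<omega> > x n)) \<longlonglongrightarrow> \<theta>"

end

theory Submission
  imports Defs
begin

text \<open>
  Shrink each block by \<open>\<gamma>\<close> on all sides.  The shrunk blocks are \<open>\<gamma>\<close>-separated, so the probability
  that none of \<open>m\<close> of them contains an exceedance is \<open>q ^ m\<close> up to \<open>m \<alpha>\<close>, where \<open>q\<close> belongs to a single
  shrunk block.  All but \<open>o(k)\<close> of the blocks meeting \<open>C\<close> lie inside \<open>C\<close>, since a convex body has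
  \<open>O(k ^ (1 - 1/d))\<close> boundary blocks, so the index set contains and is covered by \<open>m \<sim> k\<close> blocks.
  Splitting according to the last exceedance of a shrunk block in the order \<open>\<preceq>\<close>, the local condition gives
  \<open>1 - q \<ge> |J| \<theta>\<^sub>n u\<close> for a shrunk block \<open>J\<close>, the tail probability \<open>u\<close> and \<open>\<theta>\<^sub>n \<longlonglongrightarrow> \<theta>\<close>.  The
  reverse bound holds up to the probability of exceedances both in \<open>J\<close> and in the neighbouring blocks, which is
  of order \<open>1 / k\<^sup>2 + \<alpha>\<close> by separation once \<open>|D| u\<close> is bounded.  In the converse direction this
  boundedness follows from the lower bound and \<open>\<theta> > 0\<close>.  Hence \<open>q ^ m - exp (- \<theta> |D| u) \<longlonglongrightarrow> 0\<close> in
  both directions.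
\<close>

subsection \<open>Grid cells meeting the boundary of a convex body\<close>

text \<open>The block \<open>block_I\<close> as coordinate inequalities, with real sides
  \<open>t\<close>; for positive block sides the two sets agree, see
  \<open>block_I_eq_cell\<close>.\<close>

definition cell :: "real ^ 'd::finite \<Rightarrow> int ^ 'd \<Rightarrow> (real ^ 'd) set" where
  "cell t z = {y. \<forall>l. t $ l * z $ l \<le> y $ l \<and> y $ l < t $ l * (z $ l + 1)}"

lemma finite_card_int_box:
  fixes a b :: "int ^ 'd::finite"
  shows "finite {v. \<forall>l. a $ l \<le> v $ l \<and> v $ l < b $ l}"
    and "card {v. \<forall>l. a $ l \<le> v $ l \<and> v $ l < b $ l} = (\<Prod>l\<in>UNIV. nat (b $ l - a $ l))"
proof -
  let ?B = "{v. \<forall>l. a $ l \<le> v $ l \<and> v $ l < b $ l}"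
  let ?P = "PiE UNIV (\<lambda>l. {a $ l..<b $ l})"
  have bij: "bij_betw vec_nth ?B ?P"
  proof (rule bij_betw_imageI)
    show "inj_on vec_nth ?B" by (simp add: inj_on_def vec_nth_inject)
    show "vec_nth ` ?B = ?P"
    proof (intro equalityI subsetI)
      fix f assume "f \<in> ?P"
      then have "f = vec_nth (vec_lambda f)" "vec_lambda f \<in> ?B"
        by (auto simp: PiE_def Pi_def vec_lambda_beta)
      then show "f \<in> vec_nth ` ?B" by blast
    qed auto
  qed
  have "finite ?P" by (intro finite_PiE) auto
  then show "finite ?B" using bij bij_betw_finite by blast
  show "card ?B = (\<Prod>l\<in>UNIV. nat (b $ l - a $ l))"
    using bij_betw_same_card[OF bij] by (simp add: card_PiE)
qed

lemma finite_int_vec_bounded: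
  fixes S :: "(int ^ 'd::finite) set"
  assumes "\<And>z l. z \<in> S \<Longrightarrow> \<bar>z $ l\<bar> \<le> N"
  shows "finite S"
proof (rule finite_subset[OF _ finite_card_int_box(1)])
  show "S \<subseteq> {v. \<forall>l. (\<chi> l. - N) $ l \<le> v $ l \<and> v $ l < (\<chi> l. N + 1) $ l}"
  proof clarify
    fix z l assume "z \<in> S"
    from assms[OF this, of l] show "(\<chi> l. - N) $ l \<le> z $ l \<and> z $ l < (\<chi> l. N + 1) $ l" by auto
  qed
qed

text \<open>\<open>S\<close> has at most one point on each line in the diagonal direction
  \<open>s\<close>. The map \<open>f\<close> is constant along these lines and therefore injective
  on \<open>S\<close>; its coordinate \<open>o'\<close> is 0, and each other coordinate takes at
  most \<open>4 * N + 1\<close> values.\<close>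

lemma card_diagonal_antichain_le:
  fixes S :: "(int ^ 'd::finite) set" and s :: "'d \<Rightarrow> int"
  assumes S: "\<And>z l. z \<in> S \<Longrightarrow> \<bar>z $ l\<bar> \<le> int N"
    and s: "\<And>l. \<bar>s l\<bar> = 1"
    and anti: "\<And>z j. z \<in> S \<Longrightarrow> j \<ge> 1 \<Longrightarrow> (\<chi> l. z $ l + j * s l) \<notin> S"
  shows "card S \<le> (4 * N + 1) ^ (CARD('d) - 1)"
proof -
  obtain o' :: 'd where True by blast
  define f where "f z = (\<chi> l. s l * z $ l - s o' * z $ o')" for z :: "int ^ 'd"
  have ss: "s l * s l = 1" for l
    using s[of l] by (metis abs_mult_self_eq mult_1)
  have sle: "\<bar>s l * i\<bar> \<le> int N" if "\<bar>i\<bar> \<le> int N" for l i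
    using that s[of l] by (simp add: abs_mult)
  \<comment> \<open>Points with equal image differ by a multiple of \<open>s\<close>: each sign
    squares to 1, so multiplying by \<open>s l\<close> solves for \<open>z' $ l\<close>.\<close>
  have *: "z' = (\<chi> l. z $ l + (s o' * z' $ o' - s o' * z $ o') * s l)" if "f z = f z'" for z z'
  proof (simp add: vec_eq_iff, intro allI)
    fix l
    have "f z $ l = f z' $ l" using that by simp
    then have "s l * z' $ l = s l * z $ l + (s o' * z' $ o' - s o' * z $ o')" by (simp add: f_def)
    then have "s l * (s l * z' $ l) = s l * (s l * z $ l + (s o' * z' $ o' - s o' * z $ o'))" by simp
    then have "(s l * s l) * z' $ l = (s l * s l) * z $ l + s l * (s o' * z' $ o' - s o' * z $ o')"
      by (simp add: algebra_simps)
    then show "z' $ l = z $ l + (s o' * z' $ o' - s o' * z $ o') * s l" by (simp add: ss)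
  qed
  have "inj_on f S"
  proof (rule inj_onI)
    fix z z' assume z: "z \<in> S" "z' \<in> S" and e: "f z = f z'"
    have "\<not> s o' * z' $ o' - s o' * z $ o' \<ge> 1" using anti[OF z(1)] *[OF e] z(2) by metis
    moreover have "\<not> s o' * z $ o' - s o' * z' $ o' \<ge> 1" using anti[OF z(2)] *[OF e[symmetric]] z(1) by metis
    ultimately have "s o' * z' $ o' - s o' * z $ o' = 0" by linarith
    with *[OF e] show "z = z'" by (simp add: vec_eq_iff)
  qed
  define lo hi :: "int ^ 'd" where "lo = (\<chi> l. if l = o' then 0 else - 2 * int N)"
    and "hi = (\<chi> l. if l = o' then 1 else 2 * int N + 1)"
  let ?B = "{v. \<forall>l. lo $ l \<le> v $ l \<and> v $ l < hi $ l}"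
  have sub: "f ` S \<subseteq> ?B"
  proof clarify
    fix z l assume z: "z \<in> S"
    show "lo $ l \<le> f z $ l \<and> f z $ l < hi $ l"
      using sle[OF S[OF z], of l l] sle[OF S[OF z], of o' o'] by (auto simp: lo_def hi_def f_def)
  qed
  have "card S = card (f ` S)" using \<open>inj_on f S\<close> by (simp add: card_image)
  also have "\<dots> \<le> card ?B" by (rule card_mono[OF finite_card_int_box(1) sub])
  also have "\<dots> = (\<Prod>l\<in>UNIV. nat (hi $ l - lo $ l))" by (rule finite_card_int_box(2))
  also have "\<dots> = (\<Prod>l\<in>UNIV - {o'}. nat (hi $ l - lo $ l))"
    by (subst prod.remove[of _ o']) (auto simp: lo_def hi_def)
  also have "\<dots> = (\<Prod>l\<in>UNIV - {o'}. 4 * N + 1)"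
    by (rule prod.cong) (auto simp: lo_def hi_def)
  also have "\<dots> = (4 * N + 1) ^ (CARD('d) - 1)" by simp
  finally show ?thesis .
qed

text \<open>
  If a hyperplane separates \<open>K\<close> from a point of the cell \<open>z\<close> outside \<open>K\<close>, then all later cells on
  the diagonal through \<open>z\<close> whose direction has the signs of the outer normal miss \<open>K\<close>.  So every
  line in one of the \<open>2 ^ d\<close> diagonal directions contains at most one such boundary cell.
\<close>

lemma card_boundary_cells_convex_le:
  fixes K :: "(real ^ 'd::finite) set"
  assumes K: "closed K" "convex K" and t: "\<And>l. 0 < t $ l"
    and bd: "\<And>z l. cell t z \<inter> K \<noteq> {} \<Longrightarrow> \<bar>z $ l\<bar> \<le> int N"
  shows "card {z. cell t z \<inter> K \<noteq> {} \<and> \<not> cell t z \<subseteq> K} \<le> 2 ^ CARD('d) * (4 * N + 1) ^ (CARD('d) - 1)"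
proof -
  let ?S = "{z. cell t z \<inter> K \<noteq> {} \<and> \<not> cell t z \<subseteq> K}"
  define s where "s U l = (if l \<in> U then 1 else - 1 :: int)" for U :: "'d set" and l
  define SU where "SU U = {z \<in> ?S. \<forall>j\<ge>1. (\<chi> l. z $ l + j * s U l) \<notin> ?S}" for U
  have "?S \<subseteq> (\<Union>U\<in>UNIV. SU U)"
  proof
    fix z assume z: "z \<in> ?S"
    then obtain y where y: "y \<in> cell t z" "y \<notin> K" by blast
    from separating_hyperplane_closed_point[OF K(2) K(1) y(2)] obtain a \<beta> where
      a: "inner a y < \<beta>" "\<And>w. w \<in> K \<Longrightarrow> \<beta> < inner a w" by blast
    \<comment> \<open>The outer normal of the separating hyperplane is \<open>- a\<close>;
      \<open>U\<close> collects the coordinates where it is nonnegative, so a step along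
      \<open>s U\<close> never increases \<open>inner a\<close>.\<close>
    define U where "U = {l. a $ l \<le> 0}"
    have "(\<chi> l. z $ l + j * s U l) \<notin> ?S" if j: "j \<ge> 1" for j
    proof
      assume "(\<chi> l. z $ l + j * s U l) \<in> ?S"
      then obtain w where w: "w \<in> cell t (\<chi> l. z $ l + j * s U l)" "w \<in> K" by blast
      \<comment> \<open>A shift by at least one full cell moves coordinate \<open>l\<close> past
        every point of the original cell, upwards where \<open>a $ l\<close> is nonpositive and
        downwards where it is positive.\<close>
      have "a $ l * w $ l \<le> a $ l * y $ l" for l
      proof -
        have yl: "t $ l * z $ l \<le> y $ l" "y $ l < t $ l * (z $ l + 1)"
          and wl: "t $ l * (z $ l + j * s U l) \<le> w $ l" "w $ l < t $ l * (z $ l + j * s U l + 1)"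
          using y(1) w(1) by (auto simp: cell_def)
        show ?thesis
        proof (cases "a $ l \<le> 0")
          case True
          have "y $ l \<le> t $ l * (z $ l + 1)" using yl by simp
          also have "\<dots> \<le> t $ l * (z $ l + j * s U l)"
            using True j t[of l] by (intro mult_left_mono) (auto simp: U_def s_def)
          finally show ?thesis using wl True by (intro mult_left_mono_neg) auto
        next
          case False
          have "w $ l \<le> t $ l * (z $ l + j * s U l + 1)" using wl by simp
          also have "\<dots> \<le> t $ l * z $ l"
            using False j t[of l] by (intro mult_left_mono) (auto simp: U_def s_def)
          finally show ?thesis using yl False by (intro mult_left_mono) auto
        qed
      qed
      then have "inner a w \<le> inner a y" by (simp add: inner_vec_def sum_mono)
      with a(1) a(2)[OF w(2)] show False by simp
    qed
    then show "z \<in> (\<Union>U\<in>UNIV. SU U)" using z by (auto simp: SU_def)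
  qed
  moreover have fin: "finite ?S" using bd by (intro finite_int_vec_bounded[of _ "int N"]) blast
  moreover have card_SU: "card (SU U) \<le> (4 * N + 1) ^ (CARD('d) - 1)" for U
  proof (rule card_diagonal_antichain_le)
    show "\<bar>z $ l\<bar> \<le> int N" if "z \<in> SU U" for z l using that bd unfolding SU_def by blast
    show "\<bar>s U l\<bar> = 1" for l by (simp add: s_def)
    show "(\<chi> l. z $ l + j * s U l) \<notin> SU U" if "z \<in> SU U" "j \<ge> 1" for z j
      using that unfolding SU_def by blast
  qed
  ultimately have "card ?S \<le> card (\<Union>U\<in>UNIV. SU U)"
  proof (intro card_mono)
    show "finite (\<Union>U\<in>UNIV. SU U)" by (rule finite_subset[OF _ fin]) (auto simp: SU_def)
  qed
  also have "\<dots> \<le> (\<Sum>U\<in>(UNIV :: 'd set set). card (SU U))" by (rule card_UN_le) simp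
  also have "\<dots> \<le> (\<Sum>U\<in>(UNIV :: 'd set set). (4 * N + 1) ^ (CARD('d) - 1))"
    by (intro sum_mono card_SU)
  also have "\<dots> = 2 ^ CARD('d) * (4 * N + 1) ^ (CARD('d) - 1)" by (simp add: card_UNIV_set)
  finally show ?thesis .
qed

text \<open>A cell that meets the union without being contained in it meets some body and is not
  contained in that body either, so it is a boundary cell of one of the \<open>p\<close>
  bodies.\<close>

lemma card_boundary_cells_p_convex_le:
  fixes S :: "(real ^ 'd::finite) set"
  assumes S: "p_convex p S" and t: "\<And>l. 0 < t $ l"
    and bd: "\<And>z l. cell t z \<inter> S \<noteq> {} \<Longrightarrow> \<bar>z $ l\<bar> \<le> int N"
  shows "card {z. cell t z \<inter> S \<noteq> {} \<and> \<not> cell t z \<subseteq> S} \<le> p * (2 ^ CARD('d) * (4 * N + 1) ^ (CARD('d) - 1))"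
proof -
  from S obtain B :: "nat \<Rightarrow> (real ^ 'd) set" where B: "\<And>i. i \<in> {1..p} \<Longrightarrow> convex_body (B i)"
    and SB: "S = (\<Union>i\<in>{1..p}. B i)" unfolding p_convex_def by blast
  let ?F = "\<lambda>i. {z. cell t z \<inter> B i \<noteq> {} \<and> \<not> cell t z \<subseteq> B i}"
  have bdi: "\<bar>z $ l\<bar> \<le> int N" if "i \<in> {1..p}" "cell t z \<inter> B i \<noteq> {}" for z l i
  proof (rule bd)
    have "B i \<subseteq> S" using that(1) unfolding SB by (rule UN_upper)
    with that(2) show "cell t z \<inter> S \<noteq> {}" by blast
  qed
  have "finite (?F i)" if "i \<in> {1..p}" for i
    using bdi[OF that] by (intro finite_int_vec_bounded[of _ "int N"]) blast
  moreover have "{z. cell t z \<inter> S \<noteq> {} \<and> \<not> cell t z \<subseteq> S} \<subseteq> (\<Union>i\<in>{1..p}. ?F i)"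
    unfolding SB by blast
  ultimately have "card {z. cell t z \<inter> S \<noteq> {} \<and> \<not> cell t z \<subseteq> S} \<le> card (\<Union>i\<in>{1..p}. ?F i)"
    by (intro card_mono) auto
  also have "\<dots> \<le> (\<Sum>i\<in>{1..p}. card (?F i))" by (rule card_UN_le) simp
  also have "\<dots> \<le> (\<Sum>i\<in>{1..p}. 2 ^ CARD('d) * (4 * N + 1) ^ (CARD('d) - 1))"
  proof (rule sum_mono)
    fix i assume i: "i \<in> {1..p}"
    show "card (?F i) \<le> 2 ^ CARD('d) * (4 * N + 1) ^ (CARD('d) - 1)"
      using B[OF i] bdi[OF i] t
      by (intro card_boundary_cells_convex_le) (auto simp: convex_body_def compact_imp_closed)
  qed
  finally show ?thesis by simp
qed

section \<open>Volume and tiling property of the half-open cells\<close>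

lemma measure_cell:
  fixes t :: "real ^ 'd::finite"
  assumes t: "\<And>l. 0 < t $ l"
  shows "cell t z \<in> lmeasurable" "measure lebesgue (cell t z) = (\<Prod>l\<in>UNIV. t $ l)"
proof -
  define a e where "a = (\<chi> l. t $ l * real_of_int (z $ l))" and "e = (\<chi> l. t $ l * (real_of_int (z $ l) + 1))"
  \<comment> \<open>The half-open cell lies between an open and a closed box that differ by a null
    set.\<close>
  have s: "box a e \<subseteq> cell t z" "cell t z \<subseteq> cbox a e"
    by (auto simp: cell_def mem_box_cart a_def e_def less_imp_le)
  have n: "negligible (cbox a e - box a e)" by (rule negligible_frontier_interval)
  then have n': "negligible (cell t z - cbox a e \<union> (cbox a e - cell t z))"
    using s by (auto elim: negligible_subset)
  show "cell t z \<in> lmeasurable"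
    using lmeasurable_negligible_symdiff[OF lmeasurable_cbox] n' by (metis Un_commute)
  have "measure lebesgue (cell t z) = measure lebesgue (cbox a e)"
    using measure_negligible_symdiff[OF lmeasurable_cbox] n' by (metis Un_commute)
  also have "\<dots> = (\<Prod>l\<in>UNIV. t $ l)"
  proof -
    have "cbox a e \<noteq> {}" using t by (auto simp: interval_ne_empty_cart a_def e_def mult_left_mono)
    then show ?thesis by (simp add: content_cbox_cart a_def e_def algebra_simps)
  qed
  finally show "measure lebesgue (cell t z) = (\<Prod>l\<in>UNIV. t $ l)" .
qed

lemma cell_unique:
  assumes t: "\<And>l. 0 < t $ l" and y: "y \<in> cell t z" "y \<in> cell t z'"
  shows "z = z'"
proof (simp add: vec_eq_iff, intro allI)
  fix l
  have "t $ l * z $ l < t $ l * (z' $ l + 1)" "t $ l * z' $ l < t $ l * (z $ l + 1)"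
    using y by (auto simp: cell_def intro: le_less_trans)
  with t[of l] have "real_of_int (z $ l) < z' $ l + 1" "real_of_int (z' $ l) < z $ l + 1"
    by (auto simp: mult_less_cancel_left_pos)
  then show "z $ l = z' $ l" by linarith
qed

lemma ex_cell:
  assumes t: "\<And>l. 0 < t $ l"
  shows "\<exists>z. y \<in> cell t z"
proof
  have "t $ l * \<lfloor>y $ l / t $ l\<rfloor> \<le> y $ l \<and> y $ l < t $ l * (\<lfloor>y $ l / t $ l\<rfloor> + 1)" for l
  proof -
    have "\<lfloor>y $ l / t $ l\<rfloor> \<le> y $ l / t $ l" "y $ l / t $ l < \<lfloor>y $ l / t $ l\<rfloor> + 1" by linarith+
    from mult_left_mono[OF this(1), of "t $ l"] mult_strict_left_mono[OF this(2), of "t $ l"]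
    show ?thesis using t[of l] by simp
  qed
  then show "y \<in> cell t (\<chi> l. \<lfloor>y $ l / t $ l\<rfloor>)" by (simp add: cell_def)
qed

subsection \<open>Counting blocks\<close>

definition outer_cells :: "real ^ 'd::finite \<Rightarrow> (real ^ 'd) set \<Rightarrow> (int ^ 'd) set" where
  "outer_cells t S = {z. cell t z \<inter> S \<noteq> {}}"

definition inner_cells :: "real ^ 'd::finite \<Rightarrow> (real ^ 'd) set \<Rightarrow> (int ^ 'd) set" where
  "inner_cells t S = {z. cell t z \<subseteq> S}"

lemma corner_in_cell: "(\<And>l. 0 < t $ l) \<Longrightarrow> (\<chi> l. t $ l * z $ l) \<in> cell t z"
  by (simp add: cell_def)

lemma inner_subset_outer_cells:
  assumes "\<And>l. 0 < t $ l"
  shows "inner_cells t S \<subseteq> outer_cells t S"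
  using corner_in_cell[OF assms] by (fastforce simp: inner_cells_def outer_cells_def)

text \<open>A cell that meets \<open>S\<close> can start up to one side length below a point of
  \<open>S\<close>, hence the extra 1.\<close>

lemma outer_cells_abs_le:
  assumes t: "\<And>l. 0 < t $ l" and c: "\<And>l. 0 < c $ l" and S: "S \<subseteq> (*) c ` cube b" and z: "z \<in> outer_cells t S"
  shows "real_of_int \<bar>z $ l\<bar> \<le> b * (c $ l / t $ l) + 1"
proof -
  from z obtain y where y: "y \<in> cell t z" "y \<in> S" by (auto simp: outer_cells_def)
  then obtain a where a: "a \<in> cube b" "y = c * a" using S by blast
  have "- b \<le> a $ l" "a $ l \<le> b" using a(1) by (auto simp: cube_def mem_box_cart)
  then have "- (b * c $ l) \<le> y $ l" "y $ l \<le> b * c $ l"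
    using mult_left_mono[of "- b" "a $ l" "c $ l"] mult_left_mono[of "a $ l" b "c $ l"] c[of l]
    by (auto simp: a(2) mult.commute)
  moreover have "t $ l * z $ l \<le> y $ l" "y $ l < t $ l * (z $ l + 1)" using y by (auto simp: cell_def)
  ultimately have "t $ l * z $ l \<le> b * c $ l" "- (b * c $ l) \<le> t $ l * (z $ l + 1)" by auto
  then have "z $ l \<le> b * c $ l / t $ l" "- (b * c $ l / t $ l) \<le> z $ l + 1"
    using t[of l] by (simp_all add: field_simps)
  then show ?thesis by auto
qed

lemma finite_outer_cells:
  assumes t: "\<And>l. 0 < t $ l" and c: "\<And>l. 0 < c $ l" and S: "S \<subseteq> (*) c ` cube b"
  shows "finite (outer_cells t S)"
proof (rule finite_int_vec_bounded)
  fix z l assume z: "z \<in> outer_cells t S"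
  have "real_of_int \<bar>z $ l\<bar> \<le> b * (c $ l / t $ l) + 1"
    by (rule outer_cells_abs_le[OF t c S z])
  \<comment> \<open>The sum serves as one bound for all coordinates.\<close>
  also have "\<dots> \<le> (\<Sum>l\<in>UNIV. \<bar>b * (c $ l / t $ l) + 1\<bar>)"
    using member_le_sum[of l UNIV "\<lambda>l. \<bar>b * (c $ l / t $ l) + 1\<bar>"] by simp
  finally show "\<bar>z $ l\<bar> \<le> \<lceil>\<Sum>l\<in>UNIV. \<bar>b * (c $ l / t $ l) + 1\<bar>\<rceil>" by linarith
qed

lemma measure_UN_cells:
  fixes t :: "real ^ 'd::finite"
  assumes t: "\<And>l. 0 < t $ l" and Z: "finite Z"
  shows "(\<Union>z\<in>Z. cell t z) \<in> lmeasurable"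
    "measure lebesgue (\<Union>z\<in>Z. cell t z) = card Z * (\<Prod>l\<in>UNIV. t $ l)"
proof -
  show "(\<Union>z\<in>Z. cell t z) \<in> lmeasurable"
    using Z measure_cell(1)[OF t] by (intro fmeasurable.finite_UN) auto
  have "measure lebesgue (\<Union>z\<in>Z. cell t z) = (\<Sum>z\<in>Z. measure lebesgue (cell t z))"
  proof (rule measure_finite_Union[OF Z])
    show "cell t ` Z \<subseteq> sets lebesgue" using fmeasurableD[OF measure_cell(1)[OF t]] by blast
    show "disjoint_family_on (cell t) Z" using cell_unique[OF t] by (auto simp: disjoint_family_on_def)
    show "emeasure lebesgue (cell t z) \<noteq> \<infinity>" for z
      unfolding infinity_ennreal_def by (rule fmeasurableD2[OF measure_cell(1)[OF t]])
  qed
  then show "measure lebesgue (\<Union>z\<in>Z. cell t z) = card Z * (\<Prod>l\<in>UNIV. t $ l)"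
    by (simp add: measure_cell(2)[OF t])
qed

lemma emb_nth [simp]: "emb v $ l = real_of_int (v $ l)"
  by (simp add: emb_def)

lemma lattice_points_cell:
  "lattice_points (cell (emb s) z) = {v. \<forall>l. (s * z) $ l \<le> v $ l \<and> v $ l < (s * (z + 1)) $ l}"
proof -
  have "real_of_int i * j \<le> v \<longleftrightarrow> i * j \<le> v" "v < real_of_int i * (j + 1) \<longleftrightarrow> v < i * (j + 1)" for i j v :: int
    by (metis of_int_le_iff of_int_mult) (metis of_int_less_iff of_int_mult of_int_add of_int_1)
  then show ?thesis by (simp add: lattice_points_def cell_def)
qed

lemma card_lattice_points_cell:
  fixes s :: "int ^ 'd::finite"
  assumes s: "\<And>l. 0 < s $ l"
  shows "finite (lattice_points (cell (emb s) z))"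
    "real (card (lattice_points (cell (emb s) z))) = (\<Prod>l\<in>UNIV. emb s $ l)"
proof -
  show "finite (lattice_points (cell (emb s) z))"
    unfolding lattice_points_cell by (rule finite_card_int_box)
  show "real (card (lattice_points (cell (emb s) z))) = (\<Prod>l\<in>UNIV. emb s $ l)"
    unfolding lattice_points_cell finite_card_int_box(2) using s
    by (simp add: algebra_simps less_imp_le)
qed

lemma card_UN_lattice_points_cells:
  fixes s :: "int ^ 'd::finite"
  assumes s: "\<And>l. 0 < s $ l" and Z: "finite Z"
  shows "real (card (\<Union>z\<in>Z. lattice_points (cell (emb s) z))) = card Z * (\<Prod>l\<in>UNIV. emb s $ l)"
proof -
  have s': "0 < emb s $ l" for l using s by simp
  have "card (\<Union>z\<in>Z. lattice_points (cell (emb s) z)) = (\<Sum>z\<in>Z. card (lattice_points (cell (emb s) z)))"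
  proof (rule card_UN_disjoint)
  qed (use Z card_lattice_points_cell(1)[OF s] cell_unique[OF s'] in \<open>auto simp: lattice_points_def\<close>)
  then show ?thesis
    using card_lattice_points_cell(2)[OF s] by simp
qed

text \<open>Inner cells fill part of \<open>S\<close> and outer cells cover it. The lattice points
  of \<open>S\<close> obey the same two bounds in \<open>card_lattice_points_between_cells\<close>,
  so the cell counts link the volume to the cardinality.\<close>

lemma measure_between_cells:
  assumes t: "\<And>l. 0 < t $ l" and fin: "finite (outer_cells t S)" and S: "S \<in> lmeasurable"
  shows "card (inner_cells t S) * (\<Prod>l\<in>UNIV. t $ l) \<le> measure lebesgue S"
    and "measure lebesgue S \<le> card (outer_cells t S) * (\<Prod>l\<in>UNIV. t $ l)"
proof -
  have fin': "finite (inner_cells t S)"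
    by (rule finite_subset[OF inner_subset_outer_cells[OF t] fin])
  have "measure lebesgue (\<Union>z\<in>inner_cells t S. cell t z) \<le> measure lebesgue S"
  proof (rule measure_mono_fmeasurable)
    show "(\<Union>z\<in>inner_cells t S. cell t z) \<subseteq> S" by (auto simp: inner_cells_def)
    show "(\<Union>z\<in>inner_cells t S. cell t z) \<in> sets lebesgue"
      using measure_UN_cells(1)[OF t fin'] by (rule fmeasurableD)
  qed (rule S)
  then show "card (inner_cells t S) * (\<Prod>l\<in>UNIV. t $ l) \<le> measure lebesgue S"
    by (simp add: measure_UN_cells(2)[OF t fin'])
  have "measure lebesgue S \<le> measure lebesgue (\<Union>z\<in>outer_cells t S. cell t z)"
  proof (rule measure_mono_fmeasurable)
    show "S \<subseteq> (\<Union>z\<in>outer_cells t S. cell t z)"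
      using ex_cell[OF t] by (fastforce simp: outer_cells_def)
    show "S \<in> sets lebesgue" using S by (rule fmeasurableD)
  qed (rule measure_UN_cells(1)[OF t fin])
  then show "measure lebesgue S \<le> card (outer_cells t S) * (\<Prod>l\<in>UNIV. t $ l)"
    by (simp add: measure_UN_cells(2)[OF t fin])
qed

lemma lattice_points_between_cells:
  assumes t: "\<And>l. 0 < t $ l"
  shows "(\<Union>z\<in>inner_cells t S. lattice_points (cell t z)) \<subseteq> lattice_points S"
    and "lattice_points S \<subseteq> (\<Union>z\<in>outer_cells t S. lattice_points (cell t z))"
  using ex_cell[OF t] by (fastforce simp: inner_cells_def outer_cells_def lattice_points_def)+

lemma card_lattice_points_between_cells:
  assumes s: "\<And>l. 0 < s $ l" and fin: "finite (outer_cells (emb s) S)"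
  shows "card (inner_cells (emb s) S) * (\<Prod>l\<in>UNIV. emb s $ l) \<le> card (lattice_points S)"
    and "card (lattice_points S) \<le> card (outer_cells (emb s) S) * (\<Prod>l\<in>UNIV. emb s $ l)"
proof -
  have t: "0 < emb s $ l" for l using s by simp
  have fin': "finite (inner_cells (emb s) S)"
    by (rule finite_subset[OF inner_subset_outer_cells[OF t] fin])
  have finU: "finite (\<Union>z\<in>outer_cells (emb s) S. lattice_points (cell (emb s) z))"
    using fin card_lattice_points_cell(1)[OF s] by blast
  note sub = lattice_points_between_cells[OF t, of S]
  show "card (inner_cells (emb s) S) * (\<Prod>l\<in>UNIV. emb s $ l) \<le> card (lattice_points S)"
    using card_mono[OF finite_subset[OF sub(2) finU] sub(1)]
    by (simp only: of_nat_le_iff flip: card_UN_lattice_points_cells[OF s fin'])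
  show "card (lattice_points S) \<le> card (outer_cells (emb s) S) * (\<Prod>l\<in>UNIV. emb s $ l)"
    using card_mono[OF finU sub(2)] by (simp only: of_nat_le_iff flip: card_UN_lattice_points_cells[OF s fin])
qed

lemma p_convex_lmeasurable:
  assumes "p_convex p S"
  shows "S \<in> lmeasurable"
  using assms by (auto simp: p_convex_def convex_body_def intro!: fmeasurable.finite_UN lmeasurable_compact)

text \<open>The integer vector behind \<open>block_side\<close>. With integer sides the lattice
  points of a cell form an integer box, so for positive sides their number is exactly the product of
  the sides.\<close>

definition int_side :: "real ^ 'd::finite \<Rightarrow> nat \<Rightarrow> int ^ 'd" where
  "int_side c k = (\<chi> l. \<lfloor>c $ l / root CARD('d) (real k)\<rfloor>)"

lemma emb_int_side: "emb (int_side c k) = block_side c k"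
  by (simp add: emb_def int_side_def block_side_def)

lemma block_I_eq_cell:
  assumes t: "\<And>l. 0 < block_side c k $ l"
  shows "block_I c k z = cell (block_side c k) z"
proof (intro equalityI subsetI)
  fix y assume "y \<in> block_I c k z"
  then show "y \<in> cell (block_side c k) z"
    using t by (auto simp: block_I_def cell_def)
next
  fix y assume y: "y \<in> cell (block_side c k) z"
  define a where "a = (\<chi> l. y $ l / block_side c k $ l - z $ l)"
  have "y = block_side c k * (emb z + a)"
    using t by (simp add: vec_eq_iff a_def less_imp_neq[symmetric])
  moreover have "0 \<le> a $ l \<and> a $ l < 1" for l
    using y t[of l] by (auto simp: a_def cell_def field_simps)
  ultimately show "y \<in> block_I c k z" by (auto simp: block_I_def)
qed

section \<open>Asymptotics of block sides and block counts\<close>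

locale convex_blocks =
  fixes D :: "nat \<Rightarrow> (int ^ 'd::finite) set" and C :: "nat \<Rightarrow> (real ^ 'd) set"
    and c :: "nat \<Rightarrow> real ^ 'd" and k :: "nat \<Rightarrow> nat"
  assumes geometric: "geometric_assumption D C c" and adm: "admissible c k"
begin

text \<open>About \<open>r n\<close> block sides make up \<open>c n $ l\<close>; \<open>T n\<close>
  is the number of lattice points of one block once all sides are positive.\<close>

definition r where "r n = root CARD('d) (real (k n))"
definition s where "s n = int_side (c n) (k n)"
definition T where "T n = (\<Prod>l\<in>UNIV. emb (s n) $ l)"

lemma c_pos: "0 < c n $ l" and D_eq: "D n = lattice_points (C n)"
  and vol_equiv: "(\<lambda>n. \<Prod>l\<in>UNIV. c n $ l) \<sim>[sequentially] (\<lambda>n. measure lebesgue (C n))"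
  and vol_at_top: "filterlim (\<lambda>n. measure lebesgue (C n)) at_top sequentially"
  using geometric by (auto simp: geometric_assumption_def)

lemma k_pos: "0 < k n" and k_at_top: "filterlim k at_top sequentially"
  and r_over_c: "(\<lambda>n. r n / c n $ l) \<longlonglongrightarrow> 0"
  using adm by (auto simp: admissible_def r_def)

lemma real_k_at_top: "filterlim (\<lambda>n. real (k n)) at_top sequentially"
  using filterlim_compose[OF filterlim_real_sequentially k_at_top] .

lemma r_pos: "0 < r n" using k_pos by (simp add: r_def)

lemma r_ge_1: "1 \<le> r n" using k_pos[of n] by (simp add: r_def)

lemma r_power: "r n ^ CARD('d) = k n" by (simp add: r_def)

lemma r_at_top: "filterlim r at_top sequentially"
  unfolding filterlim_at_top
proof
  fix Z :: real
  have "\<forall>\<^sub>F n in sequentially. \<bar>Z\<bar> ^ CARD('d) \<le> k n"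
    using real_k_at_top by (auto simp: filterlim_at_top)
  then show "\<forall>\<^sub>F n in sequentially. Z \<le> r n"
  proof eventually_elim
    case (elim n)
    then have "\<bar>Z\<bar> ^ CARD('d) \<le> r n ^ CARD('d)" by (simp add: r_power)
    then have "\<bar>Z\<bar> \<le> r n" using r_pos[of n] by (simp add: power_mono_iff)
    then show ?case by simp
  qed
qed

lemma s_nth: "s n $ l = \<lfloor>c n $ l / r n\<rfloor>"
  by (simp add: s_def int_side_def r_def)

text \<open>Rounding down changes \<open>c n $ l / r n\<close> by at most 1, a relative error of at
  most \<open>r n / c n $ l\<close>.\<close>

lemma s_over_c: "(\<lambda>n. r n * s n $ l / c n $ l) \<longlonglongrightarrow> 1"
proof (rule real_tendsto_sandwich)
  have b: "c n $ l / r n - 1 \<le> s n $ l" "s n $ l \<le> c n $ l / r n" for n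
    unfolding s_nth by linarith+
  show "\<forall>\<^sub>F n in sequentially. 1 - r n / c n $ l \<le> r n * s n $ l / c n $ l"
  proof (rule always_eventually, rule allI)
    fix n show "1 - r n / c n $ l \<le> r n * s n $ l / c n $ l"
      using mult_left_mono[OF b(1)[of n], of "r n / c n $ l"] r_pos[of n] c_pos[of n l]
      by (simp add: algebra_simps)
  qed
  show "\<forall>\<^sub>F n in sequentially. r n * s n $ l / c n $ l \<le> 1"
  proof (rule always_eventually, rule allI)
    fix n show "r n * s n $ l / c n $ l \<le> 1"
      using mult_left_mono[OF b(2)[of n], of "r n / c n $ l"] r_pos[of n] c_pos[of n l]
      by (simp add: algebra_simps)
  qed
  show "(\<lambda>n. 1 - r n / c n $ l) \<longlonglongrightarrow> 1"
    using tendsto_diff[OF tendsto_const r_over_c] by simp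
qed simp

text \<open>The factor 2 reflects that the ratio in \<open>s_over_c\<close> eventually exceeds 1/2.
  It later bounds the coordinates of the blocks meeting \<open>C n\<close> by a multiple of
  \<open>r n\<close>.\<close>

lemma eventually_s: "\<forall>\<^sub>F n in sequentially. \<forall>l. 0 < s n $ l \<and> c n $ l \<le> 2 * r n * s n $ l"
proof (rule eventually_all_finite)
  fix l
  have "\<forall>\<^sub>F n in sequentially. 1 / 2 < r n * s n $ l / c n $ l"
    by (rule order_tendstoD(1)[OF s_over_c]) simp
  then show "\<forall>\<^sub>F n in sequentially. 0 < s n $ l \<and> c n $ l \<le> 2 * r n * s n $ l"
  proof eventually_elim
    case (elim n)
    then have *: "c n $ l < 2 * r n * s n $ l" using c_pos[of n l] by (simp add: field_simps)
    then have "0 < 2 * r n * s n $ l" using c_pos[of n l] by linarith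
    then have "0 < s n $ l" using r_pos[of n] by (simp add: zero_less_mult_iff)
    with * show ?case by simp
  qed
qed

lemma s_at_top: "filterlim (\<lambda>n. real_of_int (s n $ l)) at_top sequentially"
proof -
  have "filterlim (\<lambda>n. c n $ l / r n) at_top sequentially"
  proof -
    have "filterlim (\<lambda>n. inverse (r n / c n $ l)) at_top sequentially"
      using r_over_c r_pos c_pos by (intro filterlim_inverse_at_top) auto
    then show ?thesis by (simp add: field_simps)
  qed
  then have "filterlim (\<lambda>n. - 1 + c n $ l / r n) at_top sequentially"
    by (rule filterlim_tendsto_add_at_top[OF tendsto_const])
  then show ?thesis
    by (rule filterlim_at_top_mono) (auto simp: s_nth intro!: always_eventually)
qed

lemma eventually_T_pos: "\<forall>\<^sub>F n in sequentially. 0 < T n"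
  using eventually_s by eventually_elim (auto simp: T_def intro!: prod_pos)

lemma kT_over_c: "(\<lambda>n. k n * T n / (\<Prod>l\<in>UNIV. c n $ l)) \<longlonglongrightarrow> 1"
proof -
  have "(\<lambda>n. \<Prod>l\<in>UNIV. r n * s n $ l / c n $ l) \<longlonglongrightarrow> (\<Prod>l\<in>(UNIV :: 'd set). 1)"
    by (intro tendsto_prod s_over_c)
  moreover have "(\<Prod>l\<in>UNIV. r n * s n $ l / c n $ l) = k n * T n / (\<Prod>l\<in>UNIV. c n $ l)" for n
    by (simp add: prod_dividef prod.distrib T_def r_power)
  ultimately show ?thesis by simp
qed

lemma vol_over_kT: "(\<lambda>n. measure lebesgue (C n) / (k n * T n)) \<longlonglongrightarrow> 1"
proof -
  have ev: "\<forall>\<^sub>F n in sequentially. 0 < measure lebesgue (C n)"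
    using vol_at_top by (simp add: filterlim_at_top_dense)
  have "(\<lambda>n. (\<Prod>l\<in>UNIV. c n $ l) / measure lebesgue (C n)) \<longlonglongrightarrow> 1"
    using vol_equiv by (rule asymp_equivD_strong) (use ev in eventually_elim, auto)
  from tendsto_mult[OF kT_over_c this]
  have "(\<lambda>n. k n * T n / (\<Prod>l\<in>UNIV. c n $ l) * ((\<Prod>l\<in>UNIV. c n $ l) / measure lebesgue (C n))) \<longlonglongrightarrow> 1" by simp
  moreover have "(\<Prod>l\<in>UNIV. c n $ l) \<noteq> 0" for n
    using c_pos by (simp add: less_imp_neq[symmetric])
  ultimately have "(\<lambda>n. k n * T n / measure lebesgue (C n)) \<longlonglongrightarrow> 1" by simp
  from tendsto_inverse[OF this] show ?thesis by simp
qed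

definition hit where "hit n = outer_cells (emb (s n)) (C n)"
definition covered where "covered n = inner_cells (emb (s n)) (C n)"

text \<open>The blocks that meet \<open>C n\<close> without lying in it number at most a constant
  times \<open>r n ^ (CARD('d) - 1)\<close>, which is \<open>k n / r n\<close> and negligible
  against \<open>k n\<close>. The volume ratio lies between the two relative block counts, so both
  tend to 1, and they enclose the ratio for \<open>D n\<close>.\<close>

lemma cells_limits:
  shows "(\<lambda>n. card (hit n) / real (k n)) \<longlonglongrightarrow> 1"
    and "(\<lambda>n. card (covered n) / real (k n)) \<longlonglongrightarrow> 1"
    and "(\<lambda>n. card (D n) / (k n * T n)) \<longlonglongrightarrow> 1"
    and "\<forall>\<^sub>F n in sequentially. finite (hit n)"
proof -
  obtain p b where p: "\<And>n. p_convex p (C n)" and b: "0 < b" "\<And>n. C n \<subseteq> (*) (c n) ` cube b"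
    using geometric by (auto simp: geometric_assumption_def)
  \<comment> \<open>The constant comes from \<open>4 * N + 1 \<le> (8 * b + 9) * r n\<close>, where
    \<open>N\<close> bounds the coordinates of all blocks that meet \<open>C n\<close>.\<close>
  define A where "A = real p * (2 ^ CARD('d) * (8 * b + 9) ^ (CARD('d) - 1))"
  have ev: "\<forall>\<^sub>F n in sequentially. finite (hit n) \<and> 0 < T n \<and>
      card (covered n) * T n \<le> measure lebesgue (C n) \<and> measure lebesgue (C n) \<le> card (hit n) * T n \<and>
      card (covered n) * T n \<le> card (D n) \<and> card (D n) \<le> card (hit n) * T n \<and>
      card (covered n) \<le> card (hit n) \<and>
      (real (card (hit n)) - card (covered n)) / k n \<le> A / r n"
    using eventually_s eventually_T_pos
  proof eventually_elim
    case (elim n)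
    define t where "t = emb (s n)"
    define N where "N = nat \<lceil>2 * b * r n + 1\<rceil>"
    have t: "0 < t $ l" and s: "0 < s n $ l" for l using elim by (simp_all add: t_def)
    have fin: "finite (outer_cells t (C n))" by (rule finite_outer_cells[OF t c_pos b(2)])
    have bd: "\<bar>z $ l\<bar> \<le> int N" if "cell t z \<inter> C n \<noteq> {}" for z l
    proof -
      have "real_of_int \<bar>z $ l\<bar> \<le> b * (c n $ l / t $ l) + 1"
        by (rule outer_cells_abs_le[OF t c_pos b(2)]) (use that in \<open>simp add: outer_cells_def\<close>)
      also have "c n $ l / t $ l \<le> 2 * r n"
        using elim t[of l] by (simp add: t_def field_simps)
      then have "b * (c n $ l / t $ l) + 1 \<le> 2 * b * r n + 1"
        using b(1) mult_left_mono[of "c n $ l / t $ l" "2 * r n" b] by (simp add: mult_ac)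
      finally show ?thesis unfolding N_def by linarith
    qed
    \<comment> \<open>Subtraction of naturals is exact here because every covered block is also
      hit.\<close>
    have "card (hit n) - card (covered n) = card (hit n - covered n)"
      using fin inner_subset_outer_cells[OF t]
      by (intro card_Diff_subset[symmetric]) (auto simp: hit_def covered_def t_def intro: finite_subset)
    also have "hit n - covered n = {z. cell t z \<inter> C n \<noteq> {} \<and> \<not> cell t z \<subseteq> C n}"
      by (auto simp: hit_def covered_def t_def outer_cells_def inner_cells_def)
    also have "card \<dots> \<le> p * (2 ^ CARD('d) * (4 * N + 1) ^ (CARD('d) - 1))"
      by (rule card_boundary_cells_p_convex_le[OF p t bd])
    finally have "real (card (hit n) - card (covered n)) \<le> real (p * (2 ^ CARD('d) * (4 * N + 1) ^ (CARD('d) - 1)))"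
      by (rule of_nat_mono)
    also have "\<dots> = real p * (2 ^ CARD('d) * (4 * real N + 1) ^ (CARD('d) - 1))"
      by (simp add: add.commute)
    finally have *: "real (card (hit n) - card (covered n)) \<le> \<dots>" .
    have le: "card (covered n) \<le> card (hit n)"
      using fin inner_subset_outer_cells[OF t] by (auto simp: hit_def covered_def t_def intro: card_mono)
    have "4 * real N + 1 \<le> (8 * b + 9) * r n"
    proof -
      have "0 < 2 * b * r n + 1" using b(1) r_pos[of n] by (simp add: add_pos_pos)
      then have "real N \<le> 2 * b * r n + 2" unfolding N_def by linarith
      then show ?thesis using r_ge_1[of n] by (simp add: algebra_simps)
    qed
    then have "(4 * real N + 1) ^ (CARD('d) - 1) \<le> ((8 * b + 9) * r n) ^ (CARD('d) - 1)"
      by (intro power_mono) auto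
    then have "real p * (2 ^ CARD('d) * (4 * real N + 1) ^ (CARD('d) - 1)) \<le> A * r n ^ (CARD('d) - 1)"
      unfolding A_def by (simp add: power_mult_distrib mult.assoc mult_left_mono)
    with * le have "real (card (hit n)) - card (covered n) \<le> A * r n ^ (CARD('d) - 1)"
      by (simp add: of_nat_diff)
    then have "(real (card (hit n)) - card (covered n)) / k n \<le> A * r n ^ (CARD('d) - 1) / k n"
      by (intro divide_right_mono) auto
    also have "\<dots> = A / r n"
    proof -
      have "real (k n) = r n ^ (CARD('d) - 1) * r n"
        unfolding r_power[symmetric] by (simp flip: power_Suc2)
      then show ?thesis using r_pos[of n] by simp
    qed
    finally have **: "(real (card (hit n)) - card (covered n)) / k n \<le> A / r n" .
    show ?case
      using fin elim le ** measure_between_cells[OF t fin p_convex_lmeasurable[OF p]]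
        card_lattice_points_between_cells[OF s, of "C n"]
      by (simp add: hit_def covered_def t_def T_def D_eq)
  qed
  have A0: "(\<lambda>n. A / r n) \<longlonglongrightarrow> 0"
    using r_at_top by (intro tendsto_divide_0[OF tendsto_const] filterlim_at_top_imp_at_infinity)
  show lo: "(\<lambda>n. card (hit n) / real (k n)) \<longlonglongrightarrow> 1"
  proof (rule real_tendsto_sandwich)
    show "\<forall>\<^sub>F n in sequentially. measure lebesgue (C n) / (k n * T n) \<le> card (hit n) / real (k n)"
      using ev by eventually_elim (use k_pos in \<open>auto simp: field_simps\<close>)
    show "\<forall>\<^sub>F n in sequentially. card (hit n) / real (k n) \<le> measure lebesgue (C n) / (k n * T n) + A / r n"
      using ev
    proof eventually_elim
      case (elim n)
      have "card (covered n) / real (k n) \<le> measure lebesgue (C n) / (k n * T n)"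
        using elim k_pos[of n] by (simp add: field_simps)
      with elim show ?case by (simp add: diff_divide_distrib)
    qed
    show "(\<lambda>n. measure lebesgue (C n) / (k n * T n) + A / r n) \<longlonglongrightarrow> 1"
      using tendsto_add[OF vol_over_kT A0] by simp
  qed (rule vol_over_kT)
  show li: "(\<lambda>n. card (covered n) / real (k n)) \<longlonglongrightarrow> 1"
  proof (rule real_tendsto_sandwich)
    show "\<forall>\<^sub>F n in sequentially. card (hit n) / real (k n) - A / r n \<le> card (covered n) / real (k n)"
      using ev by eventually_elim (simp add: diff_divide_distrib)
    show "\<forall>\<^sub>F n in sequentially. card (covered n) / real (k n) \<le> card (hit n) / real (k n)"
      using ev by eventually_elim (simp add: divide_right_mono)
    show "(\<lambda>n. card (hit n) / real (k n) - A / r n) \<longlonglongrightarrow> 1"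
      using tendsto_diff[OF lo A0] by simp
  qed (rule lo)
  show "(\<lambda>n. card (D n) / (k n * T n)) \<longlonglongrightarrow> 1"
  proof (rule real_tendsto_sandwich[OF _ _ li lo])
    show "\<forall>\<^sub>F n in sequentially. card (covered n) / real (k n) \<le> card (D n) / (k n * T n)"
      using ev by eventually_elim (use k_pos in \<open>auto simp: field_simps\<close>)
    show "\<forall>\<^sub>F n in sequentially. card (D n) / (k n * T n) \<le> card (hit n) / real (k n)"
      using ev by eventually_elim (use k_pos in \<open>auto simp: field_simps\<close>)
  qed
  show "\<forall>\<^sub>F n in sequentially. finite (hit n)" using ev by eventually_elim simp
qed

end

subsection \<open>The limit of the block probabilities\<close>

text \<open>Lipschitz constant 1 for the decaying exponential on nonnegative reals: factor out
  \<open>exp (- a) \<le> 1\<close> and use \<open>1 - exp (- h) \<le> h\<close>.\<close>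

lemma abs_exp_minus_diff_le:
  fixes a b :: real
  assumes "0 \<le> a" "0 \<le> b"
  shows "\<bar>exp (- a) - exp (- b)\<bar> \<le> \<bar>a - b\<bar>"
proof -
  have *: "exp (- a) - exp (- b) \<le> b - a" if "0 \<le> a" "a \<le> b" for a b :: real
  proof -
    have "exp (- a) - exp (- b) = exp (- a) * (1 - exp (- (b - a)))"
      by (simp add: right_diff_distrib flip: exp_add)
    also have "\<dots> \<le> 1 * (b - a)"
    proof (rule mult_mono)
      show "1 - exp (- (b - a)) \<le> b - a" using exp_ge_add_one_self[of "- (b - a)"] by linarith
    qed (use that in auto)
    finally show ?thesis by simp
  qed
  show ?thesis
    using *[of a b] *[of b a] assms by (cases "a \<le> b") (auto simp: abs_if)
qed

text \<open>The \<open>m\<close>-th powers of two numbers in the unit interval differ by at most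
  \<open>m\<close> times their distance, and \<open>1 - y\<close> is within \<open>y\<^sup>2\<close>
  of \<open>exp (- y)\<close>.\<close>

lemma abs_power_minus_exp_le:
  fixes y :: real
  assumes "0 \<le> y" "y \<le> 1"
  shows "\<bar>(1 - y) ^ m - exp (- (real m * y))\<bar> \<le> real m * y\<^sup>2"
proof -
  have "exp (- y) \<le> 1 - y + y\<^sup>2"
  proof (cases "y = 0")
    case False
    have "exp (- y) \<le> inverse (1 + y)"
      using assms exp_ge_add_one_self[of y] by (simp add: exp_minus)
    also have "\<dots> \<le> 1 - y + y\<^sup>2"
    proof -
      \<comment> \<open>The product equals \<open>1 + y ^ 3\<close>.\<close>
      have "1 \<le> (1 - y + y\<^sup>2) * (1 + y)"
        using assms by (simp add: algebra_simps power2_eq_square)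
      then show ?thesis using assms by (simp add: field_simps)
    qed
    finally show ?thesis .
  qed simp
  moreover have "1 - y \<le> exp (- y)" using exp_ge_add_one_self[of "- y"] by simp
  ultimately have d: "\<bar>(1 - y) - exp (- y)\<bar> \<le> y\<^sup>2" by auto
  have "exp (- (real m * y)) = exp (- y) ^ m" by (simp flip: exp_of_nat_mult)
  then have "\<bar>(1 - y) ^ m - exp (- (real m * y))\<bar> \<le> real m * \<bar>(1 - y) - exp (- y)\<bar>"
    using norm_power_diff[of "1 - y" "exp (- y)" m] assms by simp
  also have "\<dots> \<le> real m * y\<^sup>2" using d by (intro mult_left_mono) auto
  finally show ?thesis .
qed

text \<open>Boundedness of \<open>\<kappa> n * y n\<close> replaces convergence. Passing from the
  power to an exponential costs a multiple of \<open>L\<^sup>2 / \<kappa> n\<close>; passing from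
  \<open>m n\<close> to \<open>\<kappa> n\<close> in the exponent costs at most
  \<open>\<bar>m n / \<kappa> n - 1\<bar> * L\<close>.\<close>

lemma tendsto_power_minus_exp_0:
  fixes y \<kappa> :: "nat \<Rightarrow> real" and m :: "nat \<Rightarrow> nat"
  assumes \<kappa>: "filterlim \<kappa> at_top sequentially" and m: "(\<lambda>n. m n / \<kappa> n) \<longlonglongrightarrow> 1"
    and y: "\<And>n. 0 \<le> y n" "\<And>n. y n \<le> 1" and bd: "\<forall>\<^sub>F n in sequentially. \<kappa> n * y n \<le> L"
  shows "(\<lambda>n. (1 - y n) ^ m n - exp (- (\<kappa> n * y n))) \<longlonglongrightarrow> 0"
proof (rule Lim_null_comparison)
  have pos: "\<forall>\<^sub>F n in sequentially. 0 < \<kappa> n"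
    using \<kappa> by (simp add: filterlim_at_top_dense)
  show "\<forall>\<^sub>F n in sequentially. norm ((1 - y n) ^ m n - exp (- (\<kappa> n * y n)))
      \<le> (m n / \<kappa> n) * (L\<^sup>2 / \<kappa> n) + \<bar>m n / \<kappa> n - 1\<bar> * L"
    using pos bd
  proof eventually_elim
    case (elim n)
    have a0: "0 \<le> \<kappa> n * y n" using elim y(1)[of n] by simp
    have "\<bar>(1 - y n) ^ m n - exp (- (m n * y n))\<bar> \<le> m n * (y n)\<^sup>2"
      using y by (rule abs_power_minus_exp_le)
    also have "\<dots> = (m n / \<kappa> n) * ((\<kappa> n * y n)\<^sup>2 / \<kappa> n)"
      using elim by (simp add: field_simps power2_eq_square)
    also have "\<dots> \<le> (m n / \<kappa> n) * (L\<^sup>2 / \<kappa> n)"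
      using elim a0 by (intro mult_left_mono divide_right_mono power_mono) auto
    finally have 1: "\<bar>(1 - y n) ^ m n - exp (- (m n * y n))\<bar> \<le> (m n / \<kappa> n) * (L\<^sup>2 / \<kappa> n)" .
    have "\<bar>exp (- (m n * y n)) - exp (- (\<kappa> n * y n))\<bar> \<le> \<bar>m n * y n - \<kappa> n * y n\<bar>"
      using a0 y by (intro abs_exp_minus_diff_le) auto
    also have "m n * y n - \<kappa> n * y n = (m n / \<kappa> n - 1) * (\<kappa> n * y n)"
      using elim by (simp add: field_simps)
    also have "\<bar>\<dots>\<bar> = \<bar>m n / \<kappa> n - 1\<bar> * (\<kappa> n * y n)"
      using a0 by (subst abs_mult) (simp only: abs_of_nonneg)
    also have "\<dots> \<le> \<bar>m n / \<kappa> n - 1\<bar> * L"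
      using elim by (intro mult_left_mono) auto
    finally show ?case using 1 by simp
  qed
  have "(\<lambda>n. L\<^sup>2 / \<kappa> n) \<longlonglongrightarrow> 0"
    using \<kappa> by (intro tendsto_divide_0[OF tendsto_const] filterlim_at_top_imp_at_infinity)
  moreover have "(\<lambda>n. \<bar>m n / \<kappa> n - 1\<bar>) \<longlonglongrightarrow> 0"
    using m by (intro tendsto_rabs_zero) (simp add: LIM_zero)
  ultimately show "(\<lambda>n. (m n / \<kappa> n) * (L\<^sup>2 / \<kappa> n) + \<bar>m n / \<kappa> n - 1\<bar> * L) \<longlonglongrightarrow> 0"
    using tendsto_add[OF tendsto_mult[OF m] tendsto_mult_left_zero] by fastforce
qed

text \<open>
  \<open>q\<close> is the probability of no exceedance in a shrunk block of \<open>S\<close> out of \<open>T\<close> points, and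
  \<open>mp\<close>, \<open>mi\<close> count the blocks meeting resp. contained in the index set.
\<close>

lemma block_limit_iff:
  fixes \<kappa> T S u q P N \<alpha> \<theta>n :: "nat \<Rightarrow> real" and mp mi :: "nat \<Rightarrow> nat" and \<theta> \<tau> c :: real
  assumes \<kappa>: "filterlim \<kappa> at_top sequentially"
    and mp: "(\<lambda>n. mp n / \<kappa> n) \<longlonglongrightarrow> 1" and mi: "(\<lambda>n. mi n / \<kappa> n) \<longlonglongrightarrow> 1"
    and N: "(\<lambda>n. N n / (\<kappa> n * T n)) \<longlonglongrightarrow> 1"
    and ST: "(\<lambda>n. S n / T n) \<longlonglongrightarrow> 1"
    and T: "\<forall>\<^sub>F n in sequentially. 0 < T n"
    and u: "\<And>n. 0 \<le> u n" and q: "\<And>n. 0 \<le> q n" "\<And>n. q n \<le> 1"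
    and \<alpha>: "(\<lambda>n. \<kappa> n * \<alpha> n) \<longlonglongrightarrow> 0" and \<theta>n: "\<theta>n \<longlonglongrightarrow> \<theta>" and \<theta>: "0 < \<theta>"
    and up: "\<forall>\<^sub>F n in sequentially. P n \<le> q n ^ mi n + mi n * \<alpha> n"
    and lo: "\<forall>\<^sub>F n in sequentially. q n ^ mp n - mp n * \<alpha> n - mp n * ((T n - S n) * u n) \<le> P n"
    and qlo: "\<forall>\<^sub>F n in sequentially. S n * (\<theta>n n * u n) \<le> 1 - q n"
    and qup: "\<forall>\<^sub>F n in sequentially.
      1 - q n \<le> S n * (\<theta>n n * u n) + c * (T n * u n)\<^sup>2 + \<alpha> n + (T n - S n) * u n"
  shows "(\<lambda>n. N n * u n) \<longlonglongrightarrow> \<tau> \<longleftrightarrow> P \<longlonglongrightarrow> exp (- (\<theta> * \<tau>))"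
proof -
  \<comment> \<open>The expected number of exceedances in \<open>\<kappa> n\<close> full blocks; it
    differs from \<open>N n * u n\<close> only by a factor tending to 1.\<close>
  define w where "w n = \<kappa> n * T n * u n" for n
  have pos: "\<forall>\<^sub>F n in sequentially. 0 < \<kappa> n"
    using \<kappa> by (simp add: filterlim_at_top_dense)
  have w0: "\<forall>\<^sub>F n in sequentially. 0 \<le> w n"
    using pos T by eventually_elim (simp add: w_def u)
  have Nw: "\<forall>\<^sub>F n in sequentially. N n * u n = N n / (\<kappa> n * T n) * w n"
    using pos T by eventually_elim (simp add: w_def)
  have wN: "\<forall>\<^sub>F n in sequentially. N n * u n / (N n / (\<kappa> n * T n)) = w n"
    using Nw order_tendstoD(1)[OF N zero_less_one] by eventually_elim auto
  have iff_w: "(\<lambda>n. N n * u n) \<longlonglongrightarrow> \<tau> \<longleftrightarrow> w \<longlonglongrightarrow> \<tau>"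
  proof
    assume "(\<lambda>n. N n * u n) \<longlonglongrightarrow> \<tau>"
    from tendsto_divide[OF this N] have "(\<lambda>n. N n * u n / (N n / (\<kappa> n * T n))) \<longlonglongrightarrow> \<tau>" by simp
    then show "w \<longlonglongrightarrow> \<tau>" by (rule Lim_transform_eventually) (rule wN)
  next
    assume "w \<longlonglongrightarrow> \<tau>"
    from tendsto_mult[OF N this] have "(\<lambda>n. N n / (\<kappa> n * T n) * w n) \<longlonglongrightarrow> \<tau>" by simp
    then show "(\<lambda>n. N n * u n) \<longlonglongrightarrow> \<tau>"
      by (rule Lim_transform_eventually) (use Nw in \<open>auto elim: eventually_mono\<close>)
  qed
  have lower: "\<forall>\<^sub>F n in sequentially. w n * (S n / T n * \<theta>n n) \<le> \<kappa> n * (1 - q n)"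
    using pos T qlo
  proof eventually_elim
    case (elim n)
    then show ?case
      using mult_left_mono[OF elim(3), of "\<kappa> n"] by (simp add: w_def field_simps)
  qed
  \<comment> \<open>An upper bound on \<open>w\<close> suffices here, so both directions can use
    this: in one the bound comes from convergence of \<open>w\<close>, in the other from the limit
    of \<open>P\<close>.\<close>
  have key: "(\<lambda>n. P n - exp (- (\<theta> * w n))) \<longlonglongrightarrow> 0" if W: "\<forall>\<^sub>F n in sequentially. w n \<le> W" for W
  proof -
    have wz: "(\<lambda>n. w n * f n) \<longlonglongrightarrow> 0" if f: "f \<longlonglongrightarrow> 0" for f
    proof (rule Lim_null_comparison)
      show "\<forall>\<^sub>F n in sequentially. norm (w n * f n) \<le> W * \<bar>f n\<bar>"
        using w0 W by eventually_elim (auto simp: abs_mult intro: mult_right_mono)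
      show "(\<lambda>n. W * \<bar>f n\<bar>) \<longlonglongrightarrow> 0"
        using tendsto_mult_right_zero[OF tendsto_rabs_zero[OF f]] by simp
    qed
    \<comment> \<open>The quadratic term \<open>(T n * u n)\<^sup>2\<close> of the upper bound turns
      into this product after multiplication by \<open>\<kappa> n\<close>.\<close>
    have w\<kappa>: "(\<lambda>n. w n * (w n * (1 / \<kappa> n))) \<longlonglongrightarrow> 0"
      using \<kappa> by (intro wz tendsto_divide_0[OF tendsto_const] filterlim_at_top_imp_at_infinity)
    have ST1: "(\<lambda>n. 1 - S n / T n) \<longlonglongrightarrow> 0"
      using tendsto_diff[OF tendsto_const ST, of 1] by simp
    have ST\<theta>: "(\<lambda>n. S n / T n * \<theta>n n - \<theta>) \<longlonglongrightarrow> 0"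
      using tendsto_diff[OF tendsto_mult[OF ST \<theta>n] tendsto_const, of \<theta>] by simp
    \<comment> \<open>The expected number of shrunk blocks with an exceedance among
      \<open>\<kappa> n\<close> of them.\<close>
    define a where "a n = \<kappa> n * (1 - q n)" for n
    have a0: "\<forall>\<^sub>F n in sequentially. 0 \<le> a n"
      using pos by eventually_elim (simp add: a_def q)
    have upper: "\<forall>\<^sub>F n in sequentially.
        a n \<le> w n * (S n / T n * \<theta>n n) + c * (w n * (w n * (1 / \<kappa> n))) + \<kappa> n * \<alpha> n + w n * (1 - S n / T n)"
      using pos T qup
    proof eventually_elim
      case (elim n)
      have "a n \<le> \<kappa> n * (S n * (\<theta>n n * u n) + c * (T n * u n)\<^sup>2 + \<alpha> n + (T n - S n) * u n)"
        unfolding a_def using elim by (intro mult_left_mono) auto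
      also have "\<dots> = w n * (S n / T n * \<theta>n n) + c * (w n * (w n * (1 / \<kappa> n))) + \<kappa> n * \<alpha> n + w n * (1 - S n / T n)"
        using elim by (simp add: w_def field_simps power2_eq_square)
      finally show ?case .
    qed
    have aw: "(\<lambda>n. a n - \<theta> * w n) \<longlonglongrightarrow> 0"
    proof (rule real_tendsto_sandwich)
      show "\<forall>\<^sub>F n in sequentially. w n * (S n / T n * \<theta>n n - \<theta>) \<le> a n - \<theta> * w n"
        using lower by eventually_elim (simp add: a_def algebra_simps)
      show "\<forall>\<^sub>F n in sequentially. a n - \<theta> * w n \<le> w n * (S n / T n * \<theta>n n - \<theta>)
          + c * (w n * (w n * (1 / \<kappa> n))) + \<kappa> n * \<alpha> n + w n * (1 - S n / T n)"
        using upper by eventually_elim (simp add: algebra_simps)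
      show "(\<lambda>n. w n * (S n / T n * \<theta>n n - \<theta>)) \<longlonglongrightarrow> 0" by (rule wz) (rule ST\<theta>)
      show "(\<lambda>n. w n * (S n / T n * \<theta>n n - \<theta>)
          + c * (w n * (w n * (1 / \<kappa> n))) + \<kappa> n * \<alpha> n + w n * (1 - S n / T n)) \<longlonglongrightarrow> 0"
        using wz[OF ST\<theta>] wz[OF ST1] \<alpha> tendsto_mult_right_zero[OF w\<kappa>, of c] by (auto intro!: tendsto_add_zero)
    qed
    have aL: "\<forall>\<^sub>F n in sequentially. \<kappa> n * (1 - q n) \<le> 1 + \<theta> * W"
      using order_tendstoD(2)[OF aw zero_less_one] W
    proof eventually_elim
      case (elim n)
      have "\<theta> * w n \<le> \<theta> * W" using elim \<theta> by simp
      with elim show ?case by (simp add: a_def)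
    qed
    \<comment> \<open>This applies to \<open>mp\<close> and to \<open>mi\<close>, so the lower and
      upper bounds on \<open>P n\<close> both collapse onto \<open>exp (- a n)\<close>.\<close>
    have pw: "(\<lambda>n. q n ^ m n - exp (- a n)) \<longlonglongrightarrow> 0" if "(\<lambda>n. m n / \<kappa> n) \<longlonglongrightarrow> 1" for m :: "nat \<Rightarrow> nat"
      using tendsto_power_minus_exp_0[OF \<kappa> that, of "\<lambda>n. 1 - q n", OF _ _ aL] q by (simp add: a_def)
    have Pa: "(\<lambda>n. P n - exp (- a n)) \<longlonglongrightarrow> 0"
    proof (rule real_tendsto_sandwich)
      show "\<forall>\<^sub>F n in sequentially. (q n ^ mp n - exp (- a n)) - mp n / \<kappa> n * (\<kappa> n * \<alpha> n)
          - mp n / \<kappa> n * (w n * (1 - S n / T n)) \<le> P n - exp (- a n)"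
        using pos T lo
      proof eventually_elim
        case (elim n)
        have "mp n / \<kappa> n * (w n * (1 - S n / T n)) = mp n * ((T n - S n) * u n)"
          using elim by (simp add: w_def field_simps)
        with elim show ?case by simp
      qed
      show "\<forall>\<^sub>F n in sequentially. P n - exp (- a n) \<le> (q n ^ mi n - exp (- a n)) + mi n / \<kappa> n * (\<kappa> n * \<alpha> n)"
        using pos up by eventually_elim simp
      show "(\<lambda>n. (q n ^ mp n - exp (- a n)) - mp n / \<kappa> n * (\<kappa> n * \<alpha> n)
          - mp n / \<kappa> n * (w n * (1 - S n / T n))) \<longlonglongrightarrow> 0"
        using tendsto_diff[OF tendsto_diff[OF pw[OF mp] tendsto_mult[OF mp \<alpha>]] tendsto_mult[OF mp wz[OF ST1]]]
        by simp
      show "(\<lambda>n. (q n ^ mi n - exp (- a n)) + mi n / \<kappa> n * (\<kappa> n * \<alpha> n)) \<longlonglongrightarrow> 0"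
        using tendsto_add[OF pw[OF mi] tendsto_mult[OF mi \<alpha>]] by simp
    qed
    have "(\<lambda>n. exp (- a n) - exp (- (\<theta> * w n))) \<longlonglongrightarrow> 0"
    proof (rule Lim_null_comparison)
      show "\<forall>\<^sub>F n in sequentially. norm (exp (- a n) - exp (- (\<theta> * w n))) \<le> \<bar>a n - \<theta> * w n\<bar>"
        using a0 w0
      proof eventually_elim
        case (elim n)
        then show ?case using abs_exp_minus_diff_le[of "a n" "\<theta> * w n"] \<theta> by simp
      qed
      show "(\<lambda>n. \<bar>a n - \<theta> * w n\<bar>) \<longlonglongrightarrow> 0" using aw by (rule tendsto_rabs_zero)
    qed
    from tendsto_add[OF Pa this] show ?thesis by simp
  qed
  show ?thesis
  proof (unfold iff_w, rule iffI)
    assume w: "w \<longlonglongrightarrow> \<tau>"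
    have "\<forall>\<^sub>F n in sequentially. w n \<le> \<tau> + 1"
      using order_tendstoD(2)[OF w, of "\<tau> + 1"] by (auto elim: eventually_mono)
    from key[OF this] have "(\<lambda>n. P n - exp (- (\<theta> * w n))) \<longlonglongrightarrow> 0" .
    moreover have "(\<lambda>n. exp (- (\<theta> * w n))) \<longlonglongrightarrow> exp (- (\<theta> * \<tau>))"
      using w by (intro tendsto_intros)
    ultimately have "(\<lambda>n. (P n - exp (- (\<theta> * w n))) + exp (- (\<theta> * w n))) \<longlonglongrightarrow> 0 + exp (- (\<theta> * \<tau>))"
      by (rule tendsto_add)
    then show "P \<longlonglongrightarrow> exp (- (\<theta> * \<tau>))" by simp
  next
    assume P: "P \<longlonglongrightarrow> exp (- (\<theta> * \<tau>))"
    \<comment> \<open>Half of the limit; by the upper bound on \<open>P n\<close>, the power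
      \<open>q n ^ mi n\<close> eventually stays above this positive number.\<close>
    define \<rho> where "\<rho> = exp (- (\<theta> * \<tau>)) / 2"
    have \<rho>: "0 < \<rho>" "\<rho> < exp (- (\<theta> * \<tau>))" by (auto simp: \<rho>_def)
    have "(\<lambda>n. P n - mi n / \<kappa> n * (\<kappa> n * \<alpha> n)) \<longlonglongrightarrow> exp (- (\<theta> * \<tau>))"
      using tendsto_diff[OF P tendsto_mult[OF mi \<alpha>]] by simp
    from order_tendstoD(1)[OF this \<rho>(2)]
    have ev1: "\<forall>\<^sub>F n in sequentially. \<rho> < P n - mi n / \<kappa> n * (\<kappa> n * \<alpha> n)" .
    have ev2: "\<forall>\<^sub>F n in sequentially. 1 / 2 < mi n / \<kappa> n"
      by (rule order_tendstoD(1)[OF mi]) simp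
    have "(\<lambda>n. S n / T n * \<theta>n n) \<longlonglongrightarrow> \<theta>" using tendsto_mult[OF ST \<theta>n] by simp
    then have ev3: "\<forall>\<^sub>F n in sequentially. \<theta> / 2 < S n / T n * \<theta>n n"
      using \<theta> by (intro order_tendstoD(1)) auto
    \<comment> \<open>From \<open>\<rho> \<le> q n ^ mi n \<le> exp (- (mi n * (1 - q n)))\<close>
      the mean \<open>mi n * (1 - q n)\<close> is at most \<open>- ln \<rho>\<close>. The factor 4
      combines \<open>mi n / \<kappa> n > 1 / 2\<close> with
      \<open>S n / T n * \<theta>n n > \<theta> / 2\<close>.\<close>
    have W: "\<forall>\<^sub>F n in sequentially. w n \<le> 4 * - ln \<rho> / \<theta>"
      using pos w0 up lower ev1 ev2 ev3
    proof eventually_elim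
      case (elim n)
      have "\<rho> \<le> q n ^ mi n" using elim by simp
      also have "\<dots> \<le> exp (- (1 - q n)) ^ mi n"
        using q[of n] exp_ge_add_one_self[of "- (1 - q n)"] by (intro power_mono) auto
      also have "\<dots> = exp (- (mi n * (1 - q n)))"
        by (simp add: algebra_simps flip: exp_of_nat_mult)
      finally have "ln \<rho> \<le> - (mi n * (1 - q n))"
        using \<rho>(1) by (metis ln_exp ln_le_cancel_iff exp_gt_zero)
      moreover have "1 / 2 * \<kappa> n * (1 - q n) \<le> mi n * (1 - q n)"
        using elim q(2)[of n] by (intro mult_right_mono) (auto simp: pos_less_divide_eq)
      moreover have "w n * (\<theta> / 2) \<le> w n * (S n / T n * \<theta>n n)"
        using elim by (intro mult_left_mono) auto
      ultimately have "w n * \<theta> \<le> 4 * - ln \<rho>" using elim(4) by linarith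
      then show ?case using \<theta> by (subst pos_le_divide_eq)
    qed
    from tendsto_diff[OF P key[OF W]] have "(\<lambda>n. exp (- (\<theta> * w n))) \<longlonglongrightarrow> exp (- (\<theta> * \<tau>))" by simp
    from tendsto_ln[OF this] have "(\<lambda>n. - (\<theta> * w n)) \<longlonglongrightarrow> - (\<theta> * \<tau>)" by simp
    from tendsto_divide[OF this tendsto_const, of "- \<theta>"] show "w \<longlonglongrightarrow> \<tau>" using \<theta> by simp
  qed
qed

subsection \<open>Exceedances of a stationary field\<close>

lemma finite_linear_order_has_greatest:
  assumes R: "linear_order R" and X: "finite X" "X \<noteq> {}"
  shows "\<exists>v\<in>X. \<forall>z\<in>X. (z, v) \<in> R"
  using X
proof (induction rule: finite_ne_induct)
  case (singleton x)
  then show ?case using R by (auto simp: order_on_defs refl_on_def)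
next
  case (insert x F)
  then obtain v where v: "v \<in> F" "\<forall>z\<in>F. (z, v) \<in> R" by blast
  have refl: "(x, x) \<in> R" and trans: "trans R"
    using R by (auto simp: order_on_defs refl_on_def)
  have "(x, v) \<in> R \<or> (v, x) \<in> R"
    using R refl by (cases "x = v") (auto simp: order_on_defs total_on_def)
  then show ?case
  proof
    assume "(v, x) \<in> R"
    then have "\<forall>z\<in>insert x F. (z, x) \<in> R" using v refl trans by (auto dest: transD)
    then show ?thesis by blast
  qed (use v in blast)
qed

lemma field_max_le_iff: "field_max \<xi> A \<omega> \<le> ereal y \<longleftrightarrow> (\<forall>v\<in>A. \<xi> v \<omega> \<le> y)"
  by (simp add: field_max_def SUP_le_iff)

locale stationary_field = prob_space M
  for M :: "'w measure" +
  fixes \<xi> :: "int ^ 'd::finite \<Rightarrow> 'w \<Rightarrow> real"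
  assumes field_measurable [measurable]: "\<And>v. \<xi> v \<in> borel_measurable M"
    and stat: "stationary M \<xi>"
begin

definition quiet :: "real \<Rightarrow> (int ^ 'd) set \<Rightarrow> real" where
  "quiet y A = prob {\<omega> \<in> space M. \<forall>v\<in>A. \<xi> v \<omega> \<le> y}"

definition tail :: "real \<Rightarrow> real" where
  "tail y = prob {\<omega> \<in> space M. \<xi> 0 \<omega> > y}"

text \<open>Stationarity equates laws on the product space; pulling the event \<open>P\<close> back
  along the shifted and the original path equates the probabilities.\<close>

lemma shift_prob:
  assumes P: "Measurable.pred (\<Pi>\<^sub>M v\<in>UNIV. borel) P"
  shows "prob {\<omega> \<in> space M. P (\<lambda>v. \<xi> (v + h) \<omega>)} = prob {\<omega> \<in> space M. P (\<lambda>v. \<xi> v \<omega>)}"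
proof -
  let ?N = "\<Pi>\<^sub>M v\<in>(UNIV :: (int ^ 'd) set). (borel :: real measure)"
  let ?E = "{f \<in> space ?N. P f}"
  have E: "?E \<in> sets ?N" using P by (simp add: pred_def)
  have m: "(\<lambda>\<omega> v. \<xi> (v + h) \<omega>) \<in> measurable M ?N" for h
    by (rule measurable_PiM_single') auto
  have *: "measure (distr M ?N (\<lambda>\<omega> v. \<xi> (v + h) \<omega>)) ?E = prob {\<omega> \<in> space M. P (\<lambda>v. \<xi> (v + h) \<omega>)}" for h
    using measure_distr[OF m E] by (auto simp: space_PiM intro!: arg_cong[where f = prob])
  \<comment> \<open>Shift 0 puts the original field into the same form as the shifted one.\<close>
  have "distr M ?N (\<lambda>\<omega> v. \<xi> (v + h) \<omega>) = distr M ?N (\<lambda>\<omega> v. \<xi> (v + 0) \<omega>)"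
    using stat by (simp add: stationary_def)
  with *[of h] *[of 0] show ?thesis by simp
qed

lemma quiet_shift: "quiet y ((+) h ` A) = quiet y A"
proof -
  have "{\<omega> \<in> space M. \<forall>v\<in>(+) h ` A. \<xi> v \<omega> \<le> y} = {\<omega> \<in> space M. \<forall>v\<in>A. \<xi> (v + h) \<omega> \<le> y}"
    by (auto simp: add.commute)
  then show ?thesis
    unfolding quiet_def using shift_prob[of "\<lambda>f. \<forall>v\<in>A. f v \<le> y" h] by simp
qed

lemma quiet_events [measurable]: "{\<omega> \<in> space M. \<forall>v\<in>A. \<xi> v \<omega> \<le> y} \<in> events"
  by measurable

lemma exceed_events [measurable]: "{\<omega> \<in> space M. \<exists>v\<in>A. \<xi> v \<omega> > y} \<in> events"
  by measurable

lemma prob_exceed: "prob {\<omega> \<in> space M. \<exists>v\<in>A. \<xi> v \<omega> > y} = 1 - quiet y A"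
proof -
  have "{\<omega> \<in> space M. \<exists>v\<in>A. \<xi> v \<omega> > y} = space M - {\<omega> \<in> space M. \<forall>v\<in>A. \<xi> v \<omega> \<le> y}"
    by (auto simp: not_le)
  then show ?thesis unfolding quiet_def using prob_compl[OF quiet_events] by simp
qed

lemma quiet_nonneg: "0 \<le> quiet y A" and quiet_le_1: "quiet y A \<le> 1"
  by (simp_all add: quiet_def)

lemma tail_nonneg: "0 \<le> tail y"
  by (simp add: tail_def)

lemma quiet_antimono: "A \<subseteq> B \<Longrightarrow> quiet y B \<le> quiet y A"
  unfolding quiet_def by (intro finite_measure_mono quiet_events) auto

lemma tail_shift: "prob {\<omega> \<in> space M. \<xi> h \<omega> > y} = tail y"
  unfolding tail_def using shift_prob[of "\<lambda>f. f 0 > y" h] by simp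

lemma one_minus_quiet_le:
  assumes "finite A"
  shows "1 - quiet y A \<le> card A * tail y"
proof -
  have "{\<omega> \<in> space M. \<exists>v\<in>A. \<xi> v \<omega> > y} = (\<Union>v\<in>A. {\<omega> \<in> space M. \<xi> v \<omega> > y})" by auto
  then have "1 - quiet y A \<le> (\<Sum>v\<in>A. prob {\<omega> \<in> space M. \<xi> v \<omega> > y})"
    unfolding prob_exceed[symmetric]
    by (simp only:) (intro finite_measure_subadditive_finite assms image_subsetI, measurable)
  then show ?thesis by (simp add: tail_shift)
qed

text \<open>The cost of putting removed margins back: an exceedance in \<open>B\<close> is charged
  by the union bound.\<close>

lemma quiet_Un_ge:
  assumes "finite B"
  shows "quiet y A - card B * tail y \<le> quiet y (A \<union> B)"
proof -
  have "quiet y A \<le> prob ({\<omega> \<in> space M. \<forall>v\<in>A \<union> B. \<xi> v \<omega> \<le> y} \<union> {\<omega> \<in> space M. \<exists>v\<in>B. \<xi> v \<omega> > y})"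
    unfolding quiet_def by (intro finite_measure_mono sets.Un quiet_events exceed_events) (auto simp: not_le)
  also have "\<dots> \<le> quiet y (A \<union> B) + (1 - quiet y B)"
    unfolding prob_exceed[symmetric] unfolding quiet_def
    by (intro measure_Un_le quiet_events exceed_events)
  finally show ?thesis using one_minus_quiet_le[OF assms, of y] by simp
qed

text \<open>Inclusion-exclusion expresses the joint exceedance through three no-exceedance
  probabilities, so approximate independence passes to exceedances with the same error.\<close>

lemma prob_both_exceed_le:
  assumes "\<bar>quiet y (A \<union> B) - quiet y A * quiet y B\<bar> \<le> \<alpha>"
  shows "prob {\<omega> \<in> space M. (\<exists>v\<in>A. \<xi> v \<omega> > y) \<and> (\<exists>v\<in>B. \<xi> v \<omega> > y)}
    \<le> (1 - quiet y A) * (1 - quiet y B) + \<alpha>"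
proof -
  let ?E = "\<lambda>A. {\<omega> \<in> space M. \<exists>v\<in>A. \<xi> v \<omega> > y}"
  have "prob (?E A \<union> ?E B) = prob (?E A) + prob (?E B) - prob (?E A \<inter> ?E B)"
    by (intro measure_Un3 fmeasurableI) (auto simp: less_top[symmetric])
  moreover have "?E A \<union> ?E B = ?E (A \<union> B)" by auto
  moreover have "?E A \<inter> ?E B = {\<omega> \<in> space M. (\<exists>v\<in>A. \<xi> v \<omega> > y) \<and> (\<exists>v\<in>B. \<xi> v \<omega> > y)}" by auto
  ultimately have "prob {\<omega> \<in> space M. (\<exists>v\<in>A. \<xi> v \<omega> > y) \<and> (\<exists>v\<in>B. \<xi> v \<omega> > y)}
      = 1 - quiet y A - quiet y B + quiet y (A \<union> B)"
    by (simp add: prob_exceed)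
  also have "\<dots> \<le> 1 - quiet y A - quiet y B + (quiet y A * quiet y B + \<alpha>)" using assms by auto
  finally show ?thesis by (simp add: algebra_simps)
qed

text \<open>Splitting off one set at a time costs \<alpha> per step, and multiplying the earlier
  error by a probability does not enlarge it.\<close>

lemma quiet_UN_approx:
  fixes \<alpha> :: real
  assumes Z: "finite Z" and \<alpha>: "0 \<le> \<alpha>"
    and dep: "\<And>z Z'. z \<in> Z \<Longrightarrow> Z' \<subseteq> Z \<Longrightarrow> z \<notin> Z' \<Longrightarrow>
      \<bar>quiet y (J z \<union> (\<Union>z\<in>Z'. J z)) - quiet y (J z) * quiet y (\<Union>z\<in>Z'. J z)\<bar> \<le> \<alpha>"
  shows "\<bar>quiet y (\<Union>z\<in>Z. J z) - (\<Prod>z\<in>Z. quiet y (J z))\<bar> \<le> card Z * \<alpha>"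
  using Z dep
proof (induction rule: finite_induct)
  case empty
  then show ?case by (simp add: quiet_def prob_space)
next
  case (insert z Z)
  let ?U = "\<Union>z\<in>Z. J z"
  have IH: "\<bar>quiet y ?U - (\<Prod>z\<in>Z. quiet y (J z))\<bar> \<le> card Z * \<alpha>"
    by (rule insert.IH) (use insert.prems in blast)
  have "\<bar>quiet y (J z) * quiet y ?U - quiet y (J z) * (\<Prod>z\<in>Z. quiet y (J z))\<bar>
      = quiet y (J z) * \<bar>quiet y ?U - (\<Prod>z\<in>Z. quiet y (J z))\<bar>"
    by (simp add: quiet_nonneg abs_mult flip: right_diff_distrib)
  also have "\<dots> \<le> 1 * (card Z * \<alpha>)"
    using IH by (intro mult_mono quiet_le_1) auto
  finally have "\<bar>quiet y (J z) * quiet y ?U - quiet y (J z) * (\<Prod>z\<in>Z. quiet y (J z))\<bar> \<le> card Z * \<alpha>" by simp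
  moreover have "\<bar>quiet y (J z \<union> ?U) - quiet y (J z) * quiet y ?U\<bar> \<le> \<alpha>"
    using insert by blast
  ultimately show ?case using insert.hyps by (simp add: algebra_simps)
qed

text \<open>
  An exceedance in \<open>J\<close> is either the last one within its window \<open>W v\<close> or is followed by another
  exceedance inside \<open>N\<close> but outside \<open>J\<close>, according to the last exceedance in \<open>J\<close>.
\<close>

lemma last_exceedance:
  fixes y :: real
  assumes R: "linear_order R" and J: "finite J"
    and W: "\<And>v z. v \<in> J \<Longrightarrow> z \<in> J \<Longrightarrow> (v, z) \<in> R \<Longrightarrow> v \<noteq> z \<Longrightarrow> z \<in> W v"
    and WR: "\<And>v z. z \<in> W v \<Longrightarrow> (v, z) \<in> R \<and> v \<noteq> z"
    and WN: "\<And>v. v \<in> J \<Longrightarrow> W v \<subseteq> N"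
  defines "F \<equiv> \<lambda>v. {\<omega> \<in> space M. (\<forall>z\<in>W v. \<xi> z \<omega> \<le> y) \<and> \<xi> v \<omega> > y}"
  shows "(\<Sum>v\<in>J. prob (F v)) \<le> 1 - quiet y J"
    and "1 - quiet y J \<le> (\<Sum>v\<in>J. prob (F v))
      + prob {\<omega> \<in> space M. (\<exists>v\<in>J. \<xi> v \<omega> > y) \<and> (\<exists>v\<in>N - J. \<xi> v \<omega> > y)}"
proof -
  have F [measurable]: "F v \<in> events" for v unfolding F_def by measurable
  \<comment> \<open>Of two distinct points of \<open>J\<close> the earlier one has the later one in
    its window, so the earlier one is no last exceedance when both exceed.\<close>
  have "F v \<inter> F w = {}" if vw: "v \<in> J" "w \<in> J" "v \<noteq> w" for v w
  proof -
    have "(v, w) \<in> R \<or> (w, v) \<in> R" using R vw by (auto simp: order_on_defs total_on_def)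
    then have "w \<in> W v \<or> v \<in> W w" using W vw by metis
    then show ?thesis by (auto simp: F_def)
  qed
  then have "disjoint_family_on F J" by (simp add: disjoint_family_on_def)
  then have "(\<Sum>v\<in>J. prob (F v)) = prob (\<Union>v\<in>J. F v)"
    using J F by (intro finite_measure_finite_Union[symmetric]) auto
  also have "\<dots> \<le> prob {\<omega> \<in> space M. \<exists>v\<in>J. \<xi> v \<omega> > y}"
    by (intro finite_measure_mono exceed_events) (auto simp: F_def)
  finally show "(\<Sum>v\<in>J. prob (F v)) \<le> 1 - quiet y J" by (simp add: prob_exceed)
  let ?B = "{\<omega> \<in> space M. (\<exists>v\<in>J. \<xi> v \<omega> > y) \<and> (\<exists>v\<in>N - J. \<xi> v \<omega> > y)}"
  have B: "?B \<in> events" by measurable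
  have "{\<omega> \<in> space M. \<exists>v\<in>J. \<xi> v \<omega> > y} \<subseteq> (\<Union>v\<in>J. F v) \<union> ?B"
  proof
    fix \<omega> assume "\<omega> \<in> {\<omega> \<in> space M. \<exists>v\<in>J. \<xi> v \<omega> > y}"
    then have \<omega>: "\<omega> \<in> space M" "{v \<in> J. \<xi> v \<omega> > y} \<noteq> {}" by auto
    from finite_linear_order_has_greatest[OF R _ \<omega>(2)] J obtain v where
      v: "v \<in> J" "\<xi> v \<omega> > y" "\<And>z. z \<in> J \<Longrightarrow> \<xi> z \<omega> > y \<Longrightarrow> (z, v) \<in> R" by auto
    show "\<omega> \<in> (\<Union>v\<in>J. F v) \<union> ?B"
    proof (cases "\<forall>z\<in>W v. \<xi> z \<omega> \<le> y")
      case True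
      then show ?thesis using v \<omega> by (auto simp: F_def)
    next
      case False
      then obtain z where z: "z \<in> W v" "\<xi> z \<omega> > y" by (auto simp: not_le)
      \<comment> \<open>A point of the window comes strictly after \<open>v\<close>, which is the
        greatest exceedance in \<open>J\<close>.\<close>
      have "z \<notin> J"
        using v(3)[of z] z WR[OF z(1)] R by (auto simp: order_on_defs antisym_def)
      then show ?thesis using v \<omega> z WN[OF v(1)] by blast
    qed
  qed
  then have "prob {\<omega> \<in> space M. \<exists>v\<in>J. \<xi> v \<omega> > y} \<le> prob ((\<Union>v\<in>J. F v) \<union> ?B)"
    using J F B by (intro finite_measure_mono) auto
  also have "\<dots> \<le> prob (\<Union>v\<in>J. F v) + prob ?B"
    using J F B by (intro measure_Un_le) auto
  also have "prob (\<Union>v\<in>J. F v) \<le> (\<Sum>v\<in>J. prob (F v))"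
    using J F by (intro finite_measure_subadditive_finite) auto
  finally show "1 - quiet y J \<le> (\<Sum>v\<in>J. prob (F v)) + prob ?B" by (simp add: prob_exceed)
qed

text \<open>Intended for \<open>B\<close> separated from \<open>J\<close>; the points too close to
  \<open>J\<close> for the dependence condition go into \<open>E\<close> and are paid for by a union
  bound.\<close>

lemma prob_both_exceed_split:
  assumes "finite E" "N - J \<subseteq> B \<union> E"
  shows "prob {\<omega> \<in> space M. (\<exists>v\<in>J. \<xi> v \<omega> > y) \<and> (\<exists>v\<in>N - J. \<xi> v \<omega> > y)}
    \<le> prob {\<omega> \<in> space M. (\<exists>v\<in>J. \<xi> v \<omega> > y) \<and> (\<exists>v\<in>B. \<xi> v \<omega> > y)} + card E * tail y"
proof -
  let ?X = "\<lambda>B. {\<omega> \<in> space M. (\<exists>v\<in>J. \<xi> v \<omega> > y) \<and> (\<exists>v\<in>B. \<xi> v \<omega> > y)}"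
  have X: "?X B \<in> events" for B by measurable
  have "prob (?X (N - J)) \<le> prob (?X B \<union> {\<omega> \<in> space M. \<exists>v\<in>E. \<xi> v \<omega> > y})"
    using assms(2) X exceed_events by (intro finite_measure_mono sets.Un) auto
  also have "\<dots> \<le> prob (?X B) + (1 - quiet y E)"
    unfolding prob_exceed[symmetric] using X exceed_events by (intro measure_Un_le)
  finally show ?thesis using one_minus_quiet_le[OF assms(1), of y] by simp
qed

end

subsection \<open>Shrunk blocks\<close>

lemma A_set_eq:
  assumes s: "\<And>l. 0 < s $ l" and t: "block_side c k = emb s"
  shows "A_set R c k v = {z. (\<forall>l. \<bar>z $ l - v $ l\<bar> \<le> s $ l) \<and> (v, z) \<in> R \<and> v \<noteq> z}"
proof -
  have "emb z \<in> (+) (emb v) ` (*) (emb s) ` cube 1 \<longleftrightarrow> (\<forall>l. \<bar>z $ l - v $ l\<bar> \<le> s $ l)" for z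
  proof
    assume "emb z \<in> (+) (emb v) ` (*) (emb s) ` cube 1"
    then obtain a where a: "a \<in> cube 1" "emb z = emb v + emb s * a" by auto
    show "\<forall>l. \<bar>z $ l - v $ l\<bar> \<le> s $ l"
    proof
      fix l
      have "real_of_int (z $ l) = v $ l + s $ l * a $ l" using arg_cong[OF a(2), of "\<lambda>y. y $ l"] by simp
      then have "real_of_int \<bar>z $ l - v $ l\<bar> = s $ l * \<bar>a $ l\<bar>" using s[of l] by (simp add: abs_mult)
      also have "\<dots> \<le> real_of_int (s $ l) * 1"
      proof (rule mult_left_mono)
        have "- 1 \<le> a $ l \<and> a $ l \<le> 1" using a(1) by (auto simp: cube_def mem_box_cart)
        then show "\<bar>a $ l\<bar> \<le> 1" by (simp add: abs_le_iff)
      qed (use s[of l] in simp)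
      finally show "\<bar>z $ l - v $ l\<bar> \<le> s $ l" by linarith
    qed
  next
    assume z: "\<forall>l. \<bar>z $ l - v $ l\<bar> \<le> s $ l"
    define a where "a = (\<chi> l. (real_of_int (z $ l) - v $ l) / s $ l)"
    have "emb z = emb v + emb s * a"
      using s by (simp add: vec_eq_iff a_def less_imp_neq[symmetric])
    moreover have "\<bar>a $ l\<bar> \<le> 1" for l
    proof -
      have "real_of_int \<bar>z $ l - v $ l\<bar> \<le> s $ l" using z by (simp only: of_int_le_iff)
      then show ?thesis using s[of l] by (simp add: a_def abs_divide)
    qed
    then have "a \<in> cube 1" by (auto simp: cube_def mem_box_cart abs_le_iff minus_le_iff)
    ultimately show "emb z \<in> (+) (emb v) ` (*) (emb s) ` cube 1" by blast
  qed
  then show ?thesis by (simp add: A_set_def t lattice_points_def)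
qed

lemma K_set_eq:
  assumes c: "\<And>l. 0 < c $ l"
  shows "K_set b c = {v. \<forall>l. \<bar>v $ l\<bar> \<le> b * c $ l}"
proof -
  have "emb v \<in> (*) c ` cube b \<longleftrightarrow> (\<forall>l. \<bar>v $ l\<bar> \<le> b * c $ l)" for v
  proof
    assume "emb v \<in> (*) c ` cube b"
    then obtain a where a: "a \<in> cube b" "emb v = c * a" by auto
    show "\<forall>l. \<bar>v $ l\<bar> \<le> b * c $ l"
    proof
      fix l
      have "- b \<le> a $ l \<and> a $ l \<le> b" using a(1) by (auto simp: cube_def mem_box_cart)
      then have "\<bar>a $ l\<bar> \<le> b" by (simp add: abs_le_iff minus_le_iff)
      moreover have "real_of_int (v $ l) = c $ l * a $ l" using arg_cong[OF a(2), of "\<lambda>y. y $ l"] by simp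
      ultimately show "\<bar>v $ l\<bar> \<le> b * c $ l" using c[of l] by (simp add: abs_mult mult.commute)
    qed
  next
    assume v: "\<forall>l. \<bar>v $ l\<bar> \<le> b * c $ l"
    define a where "a = (\<chi> l. v $ l / c $ l)"
    have "emb v = c * a" using c by (simp add: vec_eq_iff a_def less_imp_neq[symmetric])
    moreover have "\<bar>a $ l\<bar> \<le> b" for l
      using v c[of l] by (simp add: a_def abs_divide pos_divide_le_eq)
    then have "a \<in> cube b" by (auto simp: cube_def mem_box_cart abs_le_iff minus_le_iff)
    ultimately show "emb v \<in> (*) c ` cube b" by blast
  qed
  then show ?thesis by (simp add: K_set_def lattice_points_def)
qed

text \<open>The margin \<open>g\<close> is an integer vector, which keeps this a lattice box; the
  box is empty when some margin is at least half of its side.\<close>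

definition shrunk :: "int ^ 'd::finite \<Rightarrow> int ^ 'd \<Rightarrow> int ^ 'd \<Rightarrow> (int ^ 'd) set" where
  "shrunk s g z = {v. \<forall>l. (s * z + g) $ l \<le> v $ l \<and> v $ l < (s * (z + 1) - g) $ l}"

lemma shrunk_subset:
  assumes "\<And>l. 0 \<le> g $ l"
  shows "shrunk s g z \<subseteq> lattice_points (cell (emb s) z)"
proof
  fix v assume v: "v \<in> shrunk s g z"
  have "(s * z) $ l \<le> v $ l \<and> v $ l < (s * (z + 1)) $ l" for l
    using v assms[of l] by (auto simp: shrunk_def dest!: spec[of _ l])
  then show "v \<in> lattice_points (cell (emb s) z)" unfolding lattice_points_cell by blast
qed

lemma shrunk_shift: "shrunk s g z = (+) (s * z) ` shrunk s g 0"
proof (intro equalityI subsetI)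
  fix v assume "v \<in> shrunk s g z"
  then have "v - s * z \<in> shrunk s g 0" by (auto simp: shrunk_def algebra_simps)
  then show "v \<in> (+) (s * z) ` shrunk s g 0" by (metis add.commute diff_add_cancel image_eqI)
qed (auto simp: shrunk_def algebra_simps)

lemma finite_shrunk: "finite (shrunk s g z)"
  and card_shrunk: "card (shrunk s g z) = (\<Prod>l\<in>UNIV. nat (s $ l - 2 * g $ l))"
  unfolding shrunk_def finite_card_int_box(2)
  by (rule finite_card_int_box(1)) (simp add: algebra_simps)

lemma lattice_box_shrunk: "lattice_box (shrunk s g z)"
  unfolding lattice_box_def
  \<comment> \<open>Lattice boxes have closed bounds, so the strict upper bound drops by 1.\<close>
  by (rule exI[of _ "s * z + g"], rule exI[of _ "s * (z + 1) - g - 1"]) (auto simp: shrunk_def)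

text \<open>A displacement by \<gamma> times a vector of the unit ball moves coordinate
  \<open>l\<close> by at most \<open>g $ l\<close>, which cannot lead from the shrunk block out of
  its cell.\<close>

lemma separated_shrunk:
  assumes g: "\<And>l. \<bar>\<gamma> $ l\<bar> \<le> g $ l"
    and B: "B \<inter> lattice_points (cell (emb s) z) = {}"
  shows "separated \<gamma> (shrunk s g z) B"
  unfolding separated_def
proof clarify
  fix v assume v: "v \<in> B" "emb v \<in> emb ` shrunk s g z + (*) \<gamma> ` cball 0 1"
  then obtain a e where a: "a \<in> shrunk s g z" "e \<in> cball 0 1" "emb v = emb a + \<gamma> * e"
    by (auto elim!: set_plus_elim)
  have d: "\<bar>v $ l - a $ l\<bar> \<le> g $ l" for l
  proof -
    have "real_of_int (v $ l) = a $ l + \<gamma> $ l * e $ l" using arg_cong[OF a(3), of "\<lambda>y. y $ l"] by simp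
    then have "real_of_int \<bar>v $ l - a $ l\<bar> = \<bar>\<gamma> $ l\<bar> * \<bar>e $ l\<bar>" by (simp add: abs_mult)
    also have "\<dots> \<le> real_of_int (g $ l) * 1"
    proof (rule mult_mono)
      show "\<bar>e $ l\<bar> \<le> 1" using a(2) component_le_norm_cart[of e l] by simp
      show "0 \<le> real_of_int (g $ l)" using g[of l] by linarith
    qed (use g in auto)
    finally show ?thesis by simp
  qed
  have "(s * z) $ l \<le> v $ l \<and> v $ l < (s * (z + 1)) $ l" for l
    using a(1) d[of l] by (auto simp: shrunk_def dest!: spec[of _ l])
  then have "v \<in> lattice_points (cell (emb s) z)" unfolding lattice_points_cell by blast
  with v(1) B show False by blast
qed

section \<open>Dependence estimates for the shrunk blocks of a stationary field\<close>

context stationary_field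
begin

context
  fixes y \<alpha> :: real and \<gamma> :: "real ^ 'd" and s g :: "int ^ 'd" and K :: "(int ^ 'd) set"
  assumes s: "\<And>l. 0 < s $ l" and g: "\<And>l. \<bar>\<gamma> $ l\<bar> \<le> g $ l"
    and dep: "\<And>A B. A \<subseteq> K \<Longrightarrow> B \<subseteq> K \<Longrightarrow> separated \<gamma> A B \<Longrightarrow> lattice_box A \<Longrightarrow>
      \<bar>quiet y (A \<union> B) - quiet y A * quiet y B\<bar> \<le> \<alpha>"
begin

abbreviation "blk z \<equiv> lattice_points (cell (emb s) z)"
abbreviation "vol \<equiv> (\<Prod>l\<in>UNIV. emb s $ l)"

lemma g_nonneg: "0 \<le> g $ l"
  using g[of l] by linarith

lemma card_blk_minus_shrunk:
  "real (card (blk z - shrunk s g z)) = vol - real (card (shrunk s g 0))"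
proof -
  have le: "card (shrunk s g z) \<le> card (blk z)"
    by (intro card_mono card_lattice_points_cell(1)[OF s] shrunk_subset g_nonneg)
  have "card (blk z - shrunk s g z) = card (blk z) - card (shrunk s g z)"
    by (intro card_Diff_subset finite_shrunk shrunk_subset g_nonneg)
  then have "real (card (blk z - shrunk s g z)) = real (card (blk z)) - real (card (shrunk s g z))"
    using le by (simp add: of_nat_diff)
  then show ?thesis
    using card_lattice_points_cell(2)[OF s, of z] by (simp add: card_shrunk)
qed

lemma dep_shrunk:
  assumes "blk z \<subseteq> K" "B \<subseteq> K" "B \<inter> blk z = {}"
  shows "\<bar>quiet y (shrunk s g z \<union> B) - quiet y (shrunk s g z) * quiet y B\<bar> \<le> \<alpha>"
  using assms shrunk_subset[OF g_nonneg, of s z]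
  by (intro dep separated_shrunk lattice_box_shrunk g) auto

lemma \<alpha>_nonneg: "0 \<le> \<alpha>"
proof -
  \<comment> \<open>For two empty sets all three probabilities are 1. Lower bounds 1 above upper
    bounds 0 describe the empty box.\<close>
  have "lattice_box ({} :: (int ^ 'd) set)"
    unfolding lattice_box_def by (rule exI[of _ 1], rule exI[of _ 0]) auto
  then have "\<bar>quiet y ({} \<union> {}) - quiet y {} * quiet y {}\<bar> \<le> \<alpha>"
    by (intro dep) (auto simp: separated_def)
  then show ?thesis by linarith
qed

text \<open>Shrunk blocks are translates of each other, so stationarity gives them one common
  value.\<close>

lemma quiet_shrunk: "quiet y (shrunk s g z) = quiet y (shrunk s g 0)"
  by (subst shrunk_shift) (rule quiet_shift)

lemma quiet_UN_shrunk:
  assumes Z: "finite Z" "\<And>z. z \<in> Z \<Longrightarrow> blk z \<subseteq> K"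
  shows "\<bar>quiet y (\<Union>z\<in>Z. shrunk s g z) - quiet y (shrunk s g 0) ^ card Z\<bar> \<le> card Z * \<alpha>"
proof -
  have "\<bar>quiet y (\<Union>z\<in>Z. shrunk s g z) - (\<Prod>z\<in>Z. quiet y (shrunk s g z))\<bar> \<le> card Z * \<alpha>"
  proof (rule quiet_UN_approx[OF Z(1) \<alpha>_nonneg])
    fix z Z' assume z: "z \<in> Z" "Z' \<subseteq> Z" "z \<notin> Z'"
    have s': "0 < emb s $ l" for l using s by simp
    have sub: "shrunk s g z \<subseteq> blk z" for z by (rule shrunk_subset[OF g_nonneg])
    have "blk w \<inter> blk z = {}" if "w \<in> Z'" for w
      using cell_unique[OF s'] that z(3) by (auto simp: lattice_points_def)
    with sub have "(\<Union>z\<in>Z'. shrunk s g z) \<inter> blk z = {}" by blast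
    moreover have "(\<Union>z\<in>Z'. shrunk s g z) \<subseteq> K" using Z(2) sub z(2) by blast
    ultimately show "\<bar>quiet y (shrunk s g z \<union> (\<Union>z\<in>Z'. shrunk s g z))
        - quiet y (shrunk s g z) * quiet y (\<Union>z\<in>Z'. shrunk s g z)\<bar> \<le> \<alpha>"
      using Z(2) z(1) by (intro dep_shrunk) auto
  qed
  moreover have "(\<Prod>z\<in>Z. quiet y (shrunk s g z)) = (\<Prod>z\<in>Z. quiet y (shrunk s g 0))"
    by (rule prod.cong[OF refl quiet_shrunk])
  ultimately show ?thesis by simp
qed

text \<open>Discarding points can only raise the no-exceedance probability, so it suffices to keep
  the shrunk blocks inside \<open>D\<close>.\<close>

lemma quiet_le_power:
  assumes Z: "finite Z" "\<And>z. z \<in> Z \<Longrightarrow> blk z \<subseteq> K" and D: "(\<Union>z\<in>Z. blk z) \<subseteq> D"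
  shows "quiet y D \<le> quiet y (shrunk s g 0) ^ card Z + card Z * \<alpha>"
proof -
  have "(\<Union>z\<in>Z. shrunk s g z) \<subseteq> D" using D shrunk_subset[OF g_nonneg] by blast
  from quiet_antimono[OF this, of y] quiet_UN_shrunk[OF Z] show ?thesis by linarith
qed

text \<open>The shrunk blocks and their margins \<open>?E\<close> cover \<open>D\<close>; the
  margins are charged by the union bound, with \<open>vol - card (shrunk s g 0)\<close> points per
  block.\<close>

lemma power_le_quiet:
  assumes Z: "finite Z" "\<And>z. z \<in> Z \<Longrightarrow> blk z \<subseteq> K" and D: "D \<subseteq> (\<Union>z\<in>Z. blk z)"
  shows "quiet y (shrunk s g 0) ^ card Z - card Z * \<alpha> - card Z * ((vol - card (shrunk s g 0)) * tail y)
    \<le> quiet y D"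
proof -
  let ?E = "\<Union>z\<in>Z. blk z - shrunk s g z"
  have finE: "finite ?E" using Z(1) card_lattice_points_cell(1)[OF s] by blast
  have "real (card ?E) \<le> (\<Sum>z\<in>Z. real (card (blk z - shrunk s g z)))"
    using card_UN_le[OF Z(1), of "\<lambda>z. blk z - shrunk s g z"] by (simp flip: of_nat_sum)
  then have "real (card ?E) \<le> card Z * (vol - card (shrunk s g 0))"
    by (simp add: card_blk_minus_shrunk)
  then have "card ?E * tail y \<le> card Z * (vol - card (shrunk s g 0)) * tail y"
    by (rule mult_right_mono) (rule tail_nonneg)
  moreover have "quiet y (\<Union>z\<in>Z. shrunk s g z) - card ?E * tail y \<le> quiet y ((\<Union>z\<in>Z. shrunk s g z) \<union> ?E)"
    by (rule quiet_Un_ge[OF finE])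
  moreover have "D \<subseteq> (\<Union>z\<in>Z. shrunk s g z) \<union> ?E" using D by blast
  from quiet_antimono[OF this, of y] have "quiet y ((\<Union>z\<in>Z. shrunk s g z) \<union> ?E) \<le> quiet y D" .
  ultimately show ?thesis using quiet_UN_shrunk[OF Z] by (simp add: mult.assoc)
qed

context
  fixes R and A0 :: "(int ^ 'd) set" and p :: real
  assumes R: "transl_inv_order R"
    and A0: "A0 = {z. (\<forall>l. \<bar>z $ l\<bar> \<le> s $ l) \<and> (0, z) \<in> R \<and> 0 \<noteq> z}"
    and p: "p = prob {\<omega> \<in> space M. (\<forall>z\<in>A0. \<xi> z \<omega> \<le> y) \<and> \<xi> 0 \<omega> > y}"
    and K: "{v. \<forall>l. \<bar>v $ l\<bar> \<le> 2 * s $ l} \<subseteq> K"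
begin

text \<open>The windows are translates of \<open>A0\<close>, so by stationarity every
  last-exceedance term equals \<open>p\<close>. A second exceedance lies either in
  \<open>N - blk 0\<close>, which is separated from the shrunk block, or in the margin.\<close>

lemma quiet_shrunk_bounds:
  shows "card (shrunk s g 0) * p \<le> 1 - quiet y (shrunk s g 0)"
    and "1 - quiet y (shrunk s g 0) \<le> card (shrunk s g 0) * p + 3 ^ CARD('d) * (vol * tail y)\<^sup>2 + \<alpha>
      + (vol - card (shrunk s g 0)) * tail y"
proof -
  let ?J = "shrunk s g 0"
  define W where "W v = {z. (\<forall>l. \<bar>z $ l - v $ l\<bar> \<le> s $ l) \<and> (v, z) \<in> R \<and> v \<noteq> z}" for v
  \<comment> \<open>Windows of radius \<open>s\<close> around points of block 0 stay within the
    \<open>3 ^ CARD('d)\<close> blocks formed by block 0 and its neighbours.\<close>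
  define lo hi where "lo = - s" and "hi = 2 * s"
  define N where "N = {w. \<forall>l. lo $ l \<le> w $ l \<and> w $ l < hi $ l}"
  have lin: "linear_order R" and inv: "(u, v) \<in> R \<Longrightarrow> (u + w, v + w) \<in> R" for u v w
    using R by (auto simp: transl_inv_order_def)
  have J: "0 \<le> v $ l \<and> v $ l < s $ l" if "v \<in> blk 0" for v l
    using that by (simp add: lattice_points_cell)
  have Jblk: "?J \<subseteq> blk 0" by (rule shrunk_subset[OF g_nonneg])
  have F: "prob {\<omega> \<in> space M. (\<forall>z\<in>W v. \<xi> z \<omega> \<le> y) \<and> \<xi> v \<omega> > y} = p" for v
  proof -
    have W: "W v = (\<lambda>z. z + v) ` A0"
    proof (intro equalityI subsetI)
      fix z assume z: "z \<in> W v"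
      then have "z - v \<in> A0" using inv[of v z "- v"] by (auto simp: A0 W_def)
      then show "z \<in> (\<lambda>z. z + v) ` A0" by (metis diff_add_cancel image_eqI)
    next
      fix z assume "z \<in> (\<lambda>z. z + v) ` A0"
      then show "z \<in> W v" using inv[of 0 _ v] by (auto simp: A0 W_def)
    qed
    show ?thesis
      using shift_prob[of "\<lambda>f. (\<forall>z\<in>A0. f z \<le> y) \<and> f 0 > y" v] by (simp add: W p)
  qed
  have WJ: "z \<in> W v" if "v \<in> ?J" "z \<in> ?J" "(v, z) \<in> R" "v \<noteq> z" for v z
  proof -
    have "\<bar>z $ l - v $ l\<bar> \<le> s $ l" for l
    proof -
      have "0 \<le> v $ l \<and> v $ l < s $ l" "0 \<le> z $ l \<and> z $ l < s $ l" using J that(1,2) Jblk by blast+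
      then show ?thesis by linarith
    qed
    then show ?thesis using that(3,4) unfolding W_def by blast
  qed
  have WN: "W v \<subseteq> N" if "v \<in> ?J" for v
  proof
    fix z assume "z \<in> W v"
    then have z: "\<bar>z $ l - v $ l\<bar> \<le> s $ l" for l by (simp add: W_def)
    have v: "0 \<le> v $ l \<and> v $ l < s $ l" for l using that Jblk J by blast
    have "- s $ l \<le> z $ l \<and> z $ l < 2 * s $ l" for l
      using z[of l] v[of l] by linarith
    then show "z \<in> N" by (simp add: N_def lo_def hi_def)
  qed
  have WR: "(v, z) \<in> R \<and> v \<noteq> z" if "z \<in> W v" for v z
    using that by (simp add: W_def)
  have last1: "(\<Sum>v\<in>?J. prob {\<omega> \<in> space M. (\<forall>z\<in>W v. \<xi> z \<omega> \<le> y) \<and> \<xi> v \<omega> > y}) \<le> 1 - quiet y ?J"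
    by (rule last_exceedance(1)[OF lin finite_shrunk, where N = N], erule (3) WJ, erule WR, erule WN)
  have last2: "1 - quiet y ?J \<le> (\<Sum>v\<in>?J. prob {\<omega> \<in> space M. (\<forall>z\<in>W v. \<xi> z \<omega> \<le> y) \<and> \<xi> v \<omega> > y})
      + prob {\<omega> \<in> space M. (\<exists>v\<in>?J. \<xi> v \<omega> > y) \<and> (\<exists>v\<in>N - ?J. \<xi> v \<omega> > y)}"
    by (rule last_exceedance(2)[OF lin finite_shrunk], erule (3) WJ, erule WR, erule WN)
  from last1 show "card ?J * p \<le> 1 - quiet y ?J" by (simp add: F)
  have finN: "finite N" unfolding N_def by (rule finite_card_int_box)
  have "card N = (\<Prod>l\<in>UNIV. nat (3 * s $ l))"
    unfolding N_def finite_card_int_box(2) by (simp add: lo_def hi_def)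
  also have "real \<dots> = (\<Prod>l\<in>UNIV. 3 * real_of_int (s $ l))"
    using s by (simp add: less_imp_le)
  also have "\<dots> = 3 ^ CARD('d) * vol" by (simp add: prod.distrib)
  finally have cardN: "real (card N) = 3 ^ CARD('d) * vol" .
  have vol: "0 \<le> vol" using s by (intro prod_nonneg) (simp add: less_imp_le)
  have NK: "N \<subseteq> K"
  proof (rule subset_trans[OF _ K], clarify)
    fix v l assume "v \<in> N"
    then have "- s $ l \<le> v $ l" "v $ l < 2 * s $ l" by (auto simp: N_def lo_def hi_def)
    with s[of l] show "\<bar>v $ l\<bar> \<le> 2 * s $ l" by linarith
  qed
  have blkK: "blk 0 \<subseteq> K"
  proof (rule subset_trans[OF _ K], clarify)
    fix v l assume "v \<in> blk 0"
    from J[OF this, of l] show "\<bar>v $ l\<bar> \<le> 2 * s $ l" by linarith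
  qed
  have "prob {\<omega> \<in> space M. (\<exists>v\<in>?J. \<xi> v \<omega> > y) \<and> (\<exists>v\<in>N - ?J. \<xi> v \<omega> > y)}
    \<le> prob {\<omega> \<in> space M. (\<exists>v\<in>?J. \<xi> v \<omega> > y) \<and> (\<exists>v\<in>N - blk 0. \<xi> v \<omega> > y)} + card (blk 0 - ?J) * tail y"
    using card_lattice_points_cell(1)[OF s] by (intro prob_both_exceed_split) auto
  moreover have "prob {\<omega> \<in> space M. (\<exists>v\<in>?J. \<xi> v \<omega> > y) \<and> (\<exists>v\<in>N - blk 0. \<xi> v \<omega> > y)}
    \<le> (1 - quiet y ?J) * (1 - quiet y (N - blk 0)) + \<alpha>"
    using NK blkK by (intro prob_both_exceed_le dep_shrunk) auto
  \<comment> \<open>Union bounds over at most \<open>vol\<close> and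
    \<open>3 ^ CARD('d) * vol\<close> points produce the quadratic term.\<close>
  moreover have "(1 - quiet y ?J) * (1 - quiet y (N - blk 0)) \<le> (vol * tail y) * (3 ^ CARD('d) * vol * tail y)"
  proof (rule mult_mono)
    have "real (card ?J) \<le> vol"
      using card_mono[OF card_lattice_points_cell(1)[OF s] Jblk] card_lattice_points_cell(2)[OF s, of 0] by simp
    then have "card ?J * tail y \<le> vol * tail y" by (rule mult_right_mono) (rule tail_nonneg)
    with one_minus_quiet_le[OF finite_shrunk, of y s g 0] show "1 - quiet y ?J \<le> vol * tail y" by simp
    have "real (card (N - blk 0)) \<le> 3 ^ CARD('d) * vol"
      unfolding cardN[symmetric] using finN by (simp add: card_mono)
    then have "card (N - blk 0) * tail y \<le> 3 ^ CARD('d) * vol * tail y"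
      by (rule mult_right_mono) (rule tail_nonneg)
    with one_minus_quiet_le[of "N - blk 0" y] finN
    show "1 - quiet y (N - blk 0) \<le> 3 ^ CARD('d) * vol * tail y" by simp
  qed (use vol in \<open>auto simp: tail_nonneg quiet_le_1\<close>)
  ultimately show "1 - quiet y ?J \<le> card ?J * p + 3 ^ CARD('d) * (vol * tail y)\<^sup>2 + \<alpha> + (vol - card ?J) * tail y"
    using last2 by (simp add: F card_blk_minus_shrunk power2_eq_square algebra_simps)
qed

end

end

end

section \<open>Asymptotics of the shrunk blocks\<close>

lemma (in convex_blocks) shrunk_ratio_tendsto:
  assumes \<gamma>: "vec_smallo (\<lambda>n. root CARD('d) (real (k n)) *\<^sub>R \<gamma> n) c"
  shows "(\<lambda>n. card (shrunk (s n) (\<chi> l. \<lceil>\<bar>\<gamma> n $ l\<bar>\<rceil>) 0) / T n) \<longlonglongrightarrow> 1"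
proof -
  define g where "g n l = real_of_int \<lceil>\<bar>\<gamma> n $ l\<bar>\<rceil>" for n l
  have gs: "(\<lambda>n. g n l / s n $ l) \<longlonglongrightarrow> 0" for l
  proof (rule real_tendsto_sandwich)
    have sp: "\<forall>\<^sub>F n in sequentially. 0 < s n $ l" using eventually_s by eventually_elim simp
    show "\<forall>\<^sub>F n in sequentially. 0 \<le> g n l / s n $ l"
      using sp by eventually_elim (simp add: g_def)
    \<comment> \<open>Expanding by \<open>r n / c n $ l\<close> brings in the rate hypothesis on
      \<gamma> and the ratio of \<open>s_over_c\<close>; rounding up costs at most
      \<open>1 / s n $ l\<close>.\<close>
    show "\<forall>\<^sub>F n in sequentially. g n l / s n $ l \<le> \<bar>r n * \<gamma> n $ l / c n $ l\<bar> / (r n * s n $ l / c n $ l) + 1 / s n $ l"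
      using sp
    proof eventually_elim
      case (elim n)
      have "g n l \<le> \<bar>\<gamma> n $ l\<bar> + 1" unfolding g_def by linarith
      then have "g n l / s n $ l \<le> \<bar>\<gamma> n $ l\<bar> / s n $ l + 1 / s n $ l"
        using elim by (simp add: divide_right_mono flip: add_divide_distrib)
      also have "\<bar>\<gamma> n $ l\<bar> / s n $ l = \<bar>r n * \<gamma> n $ l / c n $ l\<bar> / (r n * s n $ l / c n $ l)"
        using r_pos[of n] c_pos[of n l] by (simp add: abs_mult abs_divide)
      finally show ?case .
    qed
    have "(\<lambda>n. \<bar>r n * \<gamma> n $ l / c n $ l\<bar>) \<longlonglongrightarrow> 0"
      using \<gamma> by (intro tendsto_rabs_zero) (simp add: vec_smallo_def r_def)
    moreover have "(\<lambda>n. 1 / real_of_int (s n $ l)) \<longlonglongrightarrow> 0"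
      using s_at_top by (intro tendsto_divide_0[OF tendsto_const] filterlim_at_top_imp_at_infinity)
    ultimately show "(\<lambda>n. \<bar>r n * \<gamma> n $ l / c n $ l\<bar> / (r n * s n $ l / c n $ l) + 1 / s n $ l) \<longlonglongrightarrow> 0"
      using tendsto_add[OF tendsto_divide[OF _ s_over_c]] by fastforce
  qed simp
  have "(\<lambda>n. \<Prod>l\<in>UNIV. 1 - 2 * (g n l / s n $ l)) \<longlonglongrightarrow> (\<Prod>l\<in>(UNIV :: 'd set). 1 - 2 * 0)"
    by (intro tendsto_prod tendsto_diff tendsto_mult tendsto_const gs)
  then have "(\<lambda>n. \<Prod>l\<in>UNIV. 1 - 2 * (g n l / s n $ l)) \<longlonglongrightarrow> 1" by simp
  \<comment> \<open>Below one half the truncation by \<open>nat\<close> in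
    \<open>card_shrunk\<close> has no effect.\<close>
  moreover have "\<forall>\<^sub>F n in sequentially. \<forall>l. g n l / s n $ l < 1 / 2"
    using gs by (intro eventually_all_finite order_tendstoD(2)) auto
  then have "\<forall>\<^sub>F n in sequentially. (\<Prod>l\<in>UNIV. 1 - 2 * (g n l / s n $ l))
      = card (shrunk (s n) (\<chi> l. \<lceil>\<bar>\<gamma> n $ l\<bar>\<rceil>) 0) / T n"
    using eventually_s
  proof eventually_elim
    case (elim n)
    have "1 - 2 * (g n l / s n $ l) = real (nat (s n $ l - 2 * \<lceil>\<bar>\<gamma> n $ l\<bar>\<rceil>)) / s n $ l" for l
    proof -
      have sp: "0 < real_of_int (s n $ l)" using elim by simp
      have "2 * g n l < s n $ l" using spec[OF elim(1), of l] sp by (simp add: field_simps)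
      then have "2 * \<lceil>\<bar>\<gamma> n $ l\<bar>\<rceil> < s n $ l" unfolding g_def by linarith
      then show ?thesis using sp by (simp add: g_def diff_divide_distrib)
    qed
    then show ?case by (simp add: card_shrunk T_def prod_dividef)
  qed
  ultimately show ?thesis by (rule Lim_transform_eventually)
qed

text \<open>Combines \<open>s n $ l \<le> c n $ l / r n\<close> with \<open>r n \<ge> 2 / b\<close>.
  The box contains the neighbours of block 0, so the dependence condition applies to them.\<close>

lemma (in convex_blocks) eventually_double_side_le:
  assumes b: "0 < b"
  shows "\<forall>\<^sub>F n in sequentially. {v. \<forall>l. \<bar>v $ l\<bar> \<le> 2 * s n $ l} \<subseteq> K_set b (c n)"
proof -
  have "\<forall>\<^sub>F n in sequentially. 2 / b \<le> r n"
    using r_at_top by (auto simp: filterlim_at_top)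
  then show ?thesis
  proof eventually_elim
    case (elim n)
    have "2 * s n $ l \<le> b * c n $ l" for l
    proof -
      have "real_of_int (s n $ l) \<le> c n $ l / r n" unfolding s_nth by linarith
      then have "r n * s n $ l \<le> c n $ l" using r_pos[of n] by (simp add: field_simps)
      moreover have "2 \<le> b * r n" using elim b by (simp add: field_simps)
      ultimately show ?thesis
      proof (cases "0 \<le> s n $ l")
        case True
        have "2 * real_of_int (s n $ l) \<le> b * r n * s n $ l"
          using \<open>2 \<le> b * r n\<close> True by (intro mult_right_mono) auto
        also have "\<dots> \<le> b * c n $ l"
          using \<open>r n * s n $ l \<le> c n $ l\<close> b by (simp add: mult.assoc)
        finally show ?thesis by simp
      next
        case False
        have "0 \<le> b * c n $ l" using b c_pos[of n l] by simp
        with False show ?thesis by linarith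
      qed
    qed
    show ?case
      unfolding K_set_eq[OF c_pos]
    proof clarify
      fix v l assume "\<forall>l. \<bar>v $ l\<bar> \<le> 2 * s n $ l"
      then have "real_of_int \<bar>v $ l\<bar> \<le> real_of_int (2 * s n $ l)" by (simp only: of_int_le_iff)
      also have "\<dots> \<le> b * c n $ l" by fact
      finally show "\<bar>v $ l\<bar> \<le> b * c n $ l" .
    qed
  qed
qed

section \<open>Verification of the block estimates along the sequence\<close>

theorem theorem3p3:
  fixes M :: "'w measure"
    and \<xi> :: "int ^ 'd::finite \<Rightarrow> 'w \<Rightarrow> real"
    and D :: "nat \<Rightarrow> (int ^ 'd) set"
    and C :: "nat \<Rightarrow> (real ^ 'd) set"
    and c :: "nat \<Rightarrow> real ^ 'd"
    and b :: real
    and x :: "nat \<Rightarrow> real"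
    and \<gamma> :: "nat \<Rightarrow> real ^ 'd"
    and \<alpha> :: "nat \<Rightarrow> real"
    and k :: "nat \<Rightarrow> nat"
    and R :: "(int ^ 'd) rel"
    and \<theta> \<tau> :: real
  assumes "geometric_assumption D C c"
    and "prob_space M"
    and "\<And>v. \<xi> v \<in> borel_measurable M"
    and "stationary M \<xi>"
    and "admissible c k"
    and "0 < b"
    and "\<And>n. D_plus (C n) (c n) (k n) \<subseteq> K_set b (c n)"
    and "cond_D M \<xi> x (\<lambda>n. K_set b (c n)) c \<gamma> \<alpha>"
    and "(\<lambda>n. real (k n) * \<alpha> n) \<longlonglongrightarrow> 0"
    and "vec_smallo (\<lambda>n. root CARD('d) (real (k n)) *\<^sub>R \<gamma> n) c"
    and "transl_inv_order R"
    and "0 < \<theta>" and "\<theta> \<le> 1"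
    and "cond_D_local M \<xi> R c x k \<theta>"
    and "0 \<le> \<tau>"
  shows "(\<lambda>n. real (card (D n)) * \<P>(\<omega> in M. \<xi> 0 \<omega> > x n)) \<longlonglongrightarrow> \<tau> \<longleftrightarrow>
         (\<lambda>n. \<P>(\<omega> in M. field_max \<xi> (D n) \<omega> \<le> ereal (x n))) \<longlonglongrightarrow> exp (- (\<theta> * \<tau>))"
proof -
  interpret prob_space M by fact
  interpret stationary_field M \<xi> using assms(3,4) by unfold_locales
  interpret convex_blocks D C c k using assms(1,5) by unfold_locales
  \<comment> \<open>Rounding the absolute values of \<gamma> up gives integer margins wide enough
    for separation.\<close>
  define g where "g n = (\<chi> l. \<lceil>\<bar>\<gamma> n $ l\<bar>\<rceil>)" for n
  define S where "S n = real (card (shrunk (s n) (g n) 0))" for n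
  define q where "q n = quiet (x n) (shrunk (s n) (g n) 0)" for n
  define A0 where "A0 n = A_set R (c n) (k n) 0" for n
  define \<theta>n where "\<theta>n n = \<P>(\<omega> in M. field_max \<xi> (A0 n) \<omega> \<le> ereal (x n) \<bar> \<xi> 0 \<omega> > x n)" for n
  have g: "\<bar>\<gamma> n $ l\<bar> \<le> g n $ l" for n l by (simp add: g_def)
  have dep: "\<bar>quiet (x n) (A \<union> B) - quiet (x n) A * quiet (x n) B\<bar> \<le> \<alpha> n"
    if "A \<subseteq> K_set b (c n)" "B \<subseteq> K_set b (c n)" "separated (\<gamma> n) A B" "lattice_box A" for n A B
    using assms(8) that unfolding cond_D_def field_max_le_iff quiet_def by blast
  \<comment> \<open>The conditional probability multiplied out; for a null conditioning event both
    sides are 0.\<close>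
  have p: "\<theta>n n * tail (x n) = prob {\<omega> \<in> space M. (\<forall>z\<in>A0 n. \<xi> z \<omega> \<le> x n) \<and> \<xi> 0 \<omega> > x n}" for n
  proof (cases "tail (x n) = 0")
    case True
    have "prob {\<omega> \<in> space M. (\<forall>z\<in>A0 n. \<xi> z \<omega> \<le> x n) \<and> \<xi> 0 \<omega> > x n} \<le> tail (x n)"
      unfolding tail_def by (intro finite_measure_mono) auto
    with True show ?thesis by (simp add: measure_le_0_iff)
  next
    case False
    then show ?thesis by (simp add: \<theta>n_def cond_prob_def field_max_le_iff tail_def)
  qed
  \<comment> \<open>A block that meets \<open>C n\<close> is part of \<open>D_plus\<close>, which
    the hypothesis places inside \<open>K_set\<close>.\<close>
  have blkK: "lattice_points (cell (emb (s n)) z) \<subseteq> K_set b (c n)" if "\<forall>l. 0 < s n $ l" "z \<in> hit n" for n z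
  proof -
    have t: "0 < block_side (c n) (k n) $ l" for l
      using that(1) by (simp add: s_def flip: emb_int_side)
    have "block_I (c n) (k n) z = cell (emb (s n)) z"
      unfolding block_I_eq_cell[OF t] by (simp add: s_def emb_int_side)
    moreover from this have "block_I (c n) (k n) z \<inter> C n \<noteq> {}"
      using that(2) by (simp add: hit_def outer_cells_def)
    ultimately have "lattice_points (cell (emb (s n)) z) \<subseteq> D_plus (C n) (c n) (k n)"
      unfolding D_plus_def block_J_def by (intro Union_upper CollectI exI[of _ z]) simp
    with assms(7) show ?thesis by blast
  qed
  have P: "\<P>(\<omega> in M. field_max \<xi> (D n) \<omega> \<le> ereal (x n)) = quiet (x n) (D n)" for n
    by (simp add: field_max_le_iff quiet_def)
  have "(\<lambda>n. real (card (D n)) * tail (x n)) \<longlonglongrightarrow> \<tau> \<longleftrightarrow>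
      (\<lambda>n. quiet (x n) (D n)) \<longlonglongrightarrow> exp (- (\<theta> * \<tau>))"
  \<comment> \<open>Here \<kappa> is \<open>k\<close>, \<open>u\<close> is the tail probability,
    \<open>mp\<close> and \<open>mi\<close> count the hit and the covered blocks, and the constant
    of the quadratic term is \<open>3 ^ CARD('d)\<close>.\<close>
  proof (rule block_limit_iff)
    show "(\<lambda>n. S n / T n) \<longlonglongrightarrow> 1"
      unfolding S_def g_def by (rule shrunk_ratio_tendsto) fact
    show "\<theta>n \<longlonglongrightarrow> \<theta>"
      using assms(14) unfolding \<theta>n_def cond_D_local_def A0_def .
    show "\<forall>\<^sub>F n in sequentially. quiet (x n) (D n) \<le> q n ^ card (covered n) + card (covered n) * \<alpha> n"
      using eventually_s cells_limits(4)
    proof eventually_elim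
      case (elim n)
      then have s: "0 < s n $ l" for l by simp
      have t: "0 < emb (s n) $ l" for l using s by simp
      have sub: "covered n \<subseteq> hit n"
        unfolding covered_def hit_def by (rule inner_subset_outer_cells[OF t])
      show ?case unfolding q_def
      proof (rule quiet_le_power[OF s g dep])
        show "finite (covered n)" using sub elim finite_subset by blast
        show "lattice_points (cell (emb (s n)) z) \<subseteq> K_set b (c n)" if "z \<in> covered n" for z
          using blkK s sub that by blast
        show "(\<Union>z\<in>covered n. lattice_points (cell (emb (s n)) z)) \<subseteq> D n"
          unfolding D_eq covered_def by (rule lattice_points_between_cells[OF t])
      qed
    qed
    show "\<forall>\<^sub>F n in sequentially. q n ^ card (hit n) - card (hit n) * \<alpha> n
        - card (hit n) * ((T n - S n) * tail (x n)) \<le> quiet (x n) (D n)"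
      using eventually_s cells_limits(4)
    proof eventually_elim
      case (elim n)
      then have s: "0 < s n $ l" for l by simp
      have t: "0 < emb (s n) $ l" for l using s by simp
      show ?case unfolding q_def T_def S_def
      proof (rule power_le_quiet[OF s g dep])
        show "finite (hit n)" using elim by simp
        show "lattice_points (cell (emb (s n)) z) \<subseteq> K_set b (c n)" if "z \<in> hit n" for z
          using blkK s that by blast
        show "D n \<subseteq> (\<Union>z\<in>hit n. lattice_points (cell (emb (s n)) z))"
          unfolding D_eq hit_def by (rule lattice_points_between_cells[OF t])
      qed
    qed
    have bounds: "\<forall>\<^sub>F n in sequentially. S n * (\<theta>n n * tail (x n)) \<le> 1 - q n \<and>
      1 - q n \<le> S n * (\<theta>n n * tail (x n)) + 3 ^ CARD('d) * (T n * tail (x n))\<^sup>2 + \<alpha> n + (T n - S n) * tail (x n)"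
      using eventually_s eventually_double_side_le[OF assms(6)]
    proof eventually_elim
      case (elim n)
      then have s: "0 < s n $ l" for l by simp
      have A0: "A0 n = {z. (\<forall>l. \<bar>z $ l\<bar> \<le> s n $ l) \<and> (0, z) \<in> R \<and> 0 \<noteq> z}"
        unfolding A0_def using A_set_eq[OF s, of "c n" "k n" R 0] by (simp add: s_def emb_int_side)
      show ?case
        unfolding q_def T_def S_def
        using quiet_shrunk_bounds[OF s g dep assms(11) A0 p elim(2)] by blast
    qed
    show "\<forall>\<^sub>F n in sequentially. S n * (\<theta>n n * tail (x n)) \<le> 1 - q n"
      using bounds by eventually_elim simp
    show "\<forall>\<^sub>F n in sequentially. 1 - q n \<le> S n * (\<theta>n n * tail (x n))
        + 3 ^ CARD('d) * (T n * tail (x n))\<^sup>2 + \<alpha> n + (T n - S n) * tail (x n)"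
      using bounds by eventually_elim simp
  qed (fact real_k_at_top cells_limits eventually_T_pos tail_nonneg assms | simp add: q_def quiet_nonneg quiet_le_1)+
  then show ?thesis by (simp add: P tail_def)
qed

end
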